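(* Let $X$ be a projective K3 surface of (geometric) Picard rank $\rho\ge3$ containing no $(-2)$-curves, defined over a number field $k$ with algebraic closure $\overline k$. For any $p\in X(\overline k)$, the natural volume of the set $$\{[\alpha]\in\partial^\circ\mathrm{Amp}_c(X)\colon h^{can}([\alpha];p)\le1\}$$ is constant on the $\mathrm{Aut}(X)$-orbit of $p$.
   Context: Boundary: $\mathrm{Amp}(X)\subset\mathrm{NS}(X)_{\mathbb R}$ is the ample cone, a component of $\{v.v>0\}$; $\partial\mathrm{Amp}(X)$ is its boundary minus the origin. Parabolic classes are the primitive integral classes $[E]\in\partial\mathrm{Amp}(X)$; each is the fiber class of a genus one fibration. $\partial^\circ\mathrm{Amp}_c(X)$ is the projective limit over $R\to\infty$ of the real projective blow-ups of $\partial\mathrm{Amp}(X)$ along the finitely many rays $\mathbb R_{>0}[E]$ with $[E]$ parabolic and $[\omega_0].[E]\le R$ ($[\omega_0]$ a fixed ample class); as a set it is $\partial\mathrm{Amp}(X)^{irr}\sqcup\bigsqcup_{[E]}\mathbb R_{>0}[E]\times\mathbb P([E]^\perp/[E])$, where $\partial\mathrm{Amp}(X)^{irr}$ consists of the classes not proportional to rational ones. Natural volume: $\partial\mathrm{Amp}(X)$ carries a measure, unique up to scaling, invariant under the group of orthogonal transformations of $\mathrm{NS}(X)_{\mathbb R}$ preserving the positive cone. In coordinates where the intersection form is $x_0^2-x_1^2-\cdots-x_{\rho-1}^2$, it is $\dfrac{dx_1\cdots dx_{\rho-1}}{(x_1^2+\cdots+x_{\rho-1}^2)^{1/2}}$.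 The volume of a subset of $\partial^\circ\mathrm{Amp}_c(X)$ is the measure of (the image of) its irrational part in $\partial\mathrm{Amp}(X)^{irr}$, which has full measure in $\partial\mathrm{Amp}(X)$. Canonical heights: $h^{can}$ is the (unique) map assigning to each $a\in\partial^\circ\mathrm{Amp}_c(X)$ a height function $h^{can}(a;\cdot)$ on $X(\overline k)$ associated to the class $[a]\in\mathrm{Pic}(X)\otimes\mathbb R$ (i.e. within a bounded function of the corresponding real combination of Weil heights) which is $\mathrm{Aut}(X)$-equivariant, $h^{can}(a;\gamma p)=h^{can}(\gamma^*a;p)$, and such that for each fixed $p$ the function $a\mapsto h^{can}(a;p)$ is non-negative, continuous on $\partial^\circ\mathrm{Amp}_c(X)$, and homogeneous of degree one under scaling. *)

theory Defs
  imports
    "HOL-Analysis.Analysis"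
    "HOL-Library.Poly_Mapping"
    "HOL-Computational_Algebra.Primes"
    "HOL-Algebra.Algebraic_Closure_Type"
begin

section \<open>Number fields and absolute heights\<close>

definition number_field :: "'k::field_char_0 itself \<Rightarrow> bool" where
  "number_field _ \<longleftrightarrow>
     (\<exists>B::'k set. finite B \<and> module.span (\<lambda>(q::rat) x. of_rat q * x) B = UNIV)"

definition is_subfield :: "'a::field set \<Rightarrow> bool" where
  "is_subfield F \<longleftrightarrow> 1 \<in> F \<and> (\<forall>x\<in>F. \<forall>y\<in>F. x - y \<in> F \<and> x * y \<in> F \<and> inverse x \<in> F)"

definition field_generated :: "'a::field set \<Rightarrow> 'a set" where
  "field_generated S = \<Inter>{F. is_subfield F \<and> S \<subseteq> F}"

definition rat_degree :: "'a::field_char_0 set \<Rightarrow> nat" where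
  "rat_degree F = vector_space.dim (\<lambda>(q::rat) x. of_rat q * x) F"

definition padic_abs :: "nat \<Rightarrow> rat \<Rightarrow> real" where
  "padic_abs p q =
     (if q = 0 then 0
      else real p powi (int (multiplicity (int p) (snd (quotient_of q)))
                        - int (multiplicity (int p) (fst (quotient_of q)))))"

definition standard_abs_values :: "(rat \<Rightarrow> real) set" where
  "standard_abs_values = insert (\<lambda>q. \<bar>of_rat q\<bar>) {padic_abs p | p. Factorial_Ring.prime p}"

text \<open>Places of a number field are the absolute values extending a standard absolute value of
  the rationals; in particular complex places carry the usual, not the squared, modulus.\<close>

definition places :: "'a::field_char_0 set \<Rightarrow> ('a \<Rightarrow> real) set" where
  "places F = {w \<in> extensional F.
     (\<forall>x\<in>F. w x \<ge> 0 \<and> (w x = 0 \<longleftrightarrow> x = 0)) \<and>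
     (\<forall>x\<in>F. \<forall>y\<in>F. w (x * y) = w x * w y \<and> w (x + y) \<le> w x + w y) \<and>
     (\<exists>a\<in>standard_abs_values. \<forall>q. w (of_rat q) = a q)}"

definition abs_Cauchy :: "('a::ab_group_add \<Rightarrow> real) \<Rightarrow> (nat \<Rightarrow> 'a) \<Rightarrow> bool" where
  "abs_Cauchy w s \<longleftrightarrow> (\<forall>e>0. \<exists>N. \<forall>m\<ge>N. \<forall>n\<ge>N. w (s m - s n) < e)"

text \<open>The local degree is the dimension of the completion of \<open>F\<close> at \<open>w\<close> over the completion of
  the rationals. Elements of completions are represented by Cauchy sequences, modulo null
  sequences; \<open>b 0, \<dots>, b (n - 1)\<close> is a basis.\<close>

definition local_degree :: "'a::field_char_0 set \<Rightarrow> ('a \<Rightarrow> real) \<Rightarrow> nat" where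
  "local_degree F w = (THE n. \<exists>b :: nat \<Rightarrow> nat \<Rightarrow> 'a.
     (\<forall>i<n. range (b i) \<subseteq> F \<and> abs_Cauchy w (b i)) \<and>
     (\<forall>s. range s \<subseteq> F \<and> abs_Cauchy w s \<longrightarrow>
        (\<exists>q :: nat \<Rightarrow> nat \<Rightarrow> rat. (\<forall>i<n. abs_Cauchy w (\<lambda>m. of_rat (q i m))) \<and>
           (\<lambda>m. w (s m - (\<Sum>i<n. of_rat (q i m) * b i m))) \<longlonglongrightarrow> 0)) \<and>
     (\<forall>q :: nat \<Rightarrow> nat \<Rightarrow> rat. (\<forall>i<n. abs_Cauchy w (\<lambda>m. of_rat (q i m))) \<and>
           (\<lambda>m. w (\<Sum>i<n. of_rat (q i m) * b i m)) \<longlonglongrightarrow> 0 \<longrightarrow>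
        (\<forall>i<n. (\<lambda>m. w (of_rat (q i m))) \<longlonglongrightarrow> 0)))"

text \<open>The absolute logarithmic Weil height of the projective point with homogeneous coordinates
  \<open>v\<close> (a nonzero vector with finitely many nonzero entries), computed over the number field
  generated by the coordinates. All but finitely many places contribute zero.\<close>

definition vector_height :: "(nat \<Rightarrow> 'a::field_char_0) \<Rightarrow> real" where
  "vector_height v =
     (let F = field_generated (range v) in
       (\<Sum>w\<in>{w \<in> places F. Max (range (\<lambda>i. w (v i))) \<noteq> 1}.
          real (local_degree F w) * ln (Max (range (\<lambda>i. w (v i))))) / real (rat_degree F))"


section \<open>Projective sets and regular functions\<close>

text \<open>A point of projective space is the set of all its homogeneous coordinate vectors. Vectors are
  indexed by all natural numbers, with zero entries beyond the dimension, so that projective spaces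
  of all dimensions share one type.\<close>

type_synonym 'a point = "(nat \<Rightarrow> 'a) set"
type_synonym 'a mpolynomial = "(nat \<Rightarrow>\<^sub>0 nat) \<Rightarrow>\<^sub>0 'a"

definition proj_point :: "(nat \<Rightarrow> 'a::field) \<Rightarrow> 'a point" where
  "proj_point v = {(\<lambda>i. c * v i) | c. c \<noteq> 0}"

definition proj_space :: "nat \<Rightarrow> 'a::field point set" where
  "proj_space N = {proj_point v | v. (\<exists>i. v i \<noteq> 0) \<and> (\<forall>i>N. v i = 0)}"

definition mpoly_eval :: "'a::field mpolynomial \<Rightarrow> (nat \<Rightarrow> 'a) \<Rightarrow> 'a" where
  "mpoly_eval p v = (\<Sum>m\<in>Poly_Mapping.keys p. Poly_Mapping.lookup p m *
     (\<Prod>i\<in>Poly_Mapping.keys m. v i ^ Poly_Mapping.lookup m i))"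

definition homogeneous :: "nat \<Rightarrow> 'a::field mpolynomial \<Rightarrow> bool" where
  "homogeneous d p \<longleftrightarrow>
     (\<forall>m\<in>Poly_Mapping.keys p. (\<Sum>i\<in>Poly_Mapping.keys m. Poly_Mapping.lookup m i) = d)"

definition vanishes :: "'a::field mpolynomial \<Rightarrow> 'a point \<Rightarrow> bool" where
  "vanishes p x \<longleftrightarrow> (\<forall>v\<in>x. mpoly_eval p v = 0)"

definition projective_set :: "'a::field set \<Rightarrow> nat \<Rightarrow> 'a point set \<Rightarrow> bool" where
  "projective_set k N \<V> \<longleftrightarrow> (\<exists>S.
     (\<forall>p\<in>S. (\<exists>d. homogeneous d p) \<and> (\<forall>m. Poly_Mapping.lookup p m \<in> k)) \<and>
     \<V> = {x \<in> proj_space N. \<forall>p\<in>S. vanishes p x})"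

definition zopen :: "'a::field point set \<Rightarrow> 'a point set \<Rightarrow> bool" where
  "zopen \<V> U \<longleftrightarrow> (\<exists>S. (\<forall>p\<in>S. \<exists>d. homogeneous d p) \<and> U = {x \<in> \<V>. \<exists>p\<in>S. \<not> vanishes p x})"

definition zclosed :: "'a::field point set \<Rightarrow> 'a point set \<Rightarrow> bool" where
  "zclosed \<V> Z \<longleftrightarrow> Z \<subseteq> \<V> \<and> zopen \<V> (\<V> - Z)"

definition irreducible_closed :: "'a::field point set \<Rightarrow> 'a point set \<Rightarrow> bool" where
  "irreducible_closed \<V> Z \<longleftrightarrow> zclosed \<V> Z \<and> Z \<noteq> {} \<and>
     (\<forall>A B. zclosed \<V> A \<and> zclosed \<V> B \<and> Z = A \<union> B \<longrightarrow> Z = A \<or> Z = B)"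

definition irreducible_chain :: "'a::field point set \<Rightarrow> nat \<Rightarrow> bool" where
  "irreducible_chain \<V> n \<longleftrightarrow>
     (\<exists>Z. (\<forall>i\<le>n. irreducible_closed \<V> (Z i)) \<and> (\<forall>i<n. Z i \<subset> Z (Suc i)))"

definition has_dimension :: "'a::field point set \<Rightarrow> nat \<Rightarrow> bool" where
  "has_dimension \<V> n \<longleftrightarrow> irreducible_chain \<V> n \<and> \<not> irreducible_chain \<V> (Suc n)"

text \<open>Regular and rational functions are represented by total functions on points; only the values
  on the open set under consideration matter.\<close>

type_synonym 'a pfun = "'a point \<Rightarrow> 'a"

definition regular_on :: "'a::field point set \<Rightarrow> 'a point set \<Rightarrow> 'a pfun \<Rightarrow> bool" where
  "regular_on \<V> U f \<longleftrightarrow> zopen \<V> U \<and> (\<forall>x\<in>U. \<exists>V g h d. zopen \<V> V \<and> x \<in> V \<and> V \<subseteq> U \<and>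
     homogeneous d g \<and> homogeneous d h \<and>
     (\<forall>y\<in>V. \<forall>v\<in>y. mpoly_eval h v \<noteq> 0 \<and> f y = mpoly_eval g v / mpoly_eval h v))"

definition local_ring :: "'a::field point set \<Rightarrow> 'a point \<Rightarrow> 'a pfun set" where
  "local_ring \<V> x = {f. \<exists>U. x \<in> U \<and> regular_on \<V> U f}"

definition generically_equal :: "'a::field point set \<Rightarrow> 'a pfun \<Rightarrow> 'a pfun \<Rightarrow> bool" where
  "generically_equal \<V> f g \<longleftrightarrow> (\<exists>U. zopen \<V> U \<and> U \<noteq> {} \<and> (\<forall>x\<in>U. f x = g x))"

definition nonzero_rational :: "'a::field point set \<Rightarrow> 'a pfun \<Rightarrow> bool" where
  "nonzero_rational \<V> f \<longleftrightarrow> (\<exists>U. U \<noteq> {} \<and> regular_on \<V> U f \<and> (\<forall>x\<in>U. f x \<noteq> 0))"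

definition variety_iso ::
    "'a::field point set \<Rightarrow> 'a point set \<Rightarrow> ('a point \<Rightarrow> 'a point) \<Rightarrow> bool" where
  "variety_iso \<V> Y \<phi> \<longleftrightarrow> bij_betw \<phi> \<V> Y \<and>
     (\<forall>V\<subseteq>Y. zopen Y V \<longleftrightarrow> zopen \<V> (\<V> \<inter> \<phi> -` V)) \<and>
     (\<forall>V f. zopen Y V \<longrightarrow> (regular_on Y V f \<longleftrightarrow> regular_on \<V> (\<V> \<inter> \<phi> -` V) (f \<circ> \<phi>)))"

definition automorphisms :: "'a::field point set \<Rightarrow> ('a point \<Rightarrow> 'a point) set" where
  "automorphisms \<V> = {\<gamma>. variety_iso \<V> \<V> \<gamma>}"


section \<open>K3 surfaces\<close>

text \<open>The dimension of \<open>V / W\<close> for vector spaces \<open>W \<subseteq> V\<close> of functions: \<open>b 0, \<dots>, b (n - 1)\<close>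
  represents a basis.\<close>

definition has_quotient_dim :: "('p \<Rightarrow> 'a::field) set \<Rightarrow> ('p \<Rightarrow> 'a) set \<Rightarrow> nat \<Rightarrow> bool" where
  "has_quotient_dim V W n \<longleftrightarrow> (\<exists>b :: nat \<Rightarrow> 'p \<Rightarrow> 'a. (\<forall>i<n. b i \<in> V) \<and>
     (\<forall>f\<in>V. \<exists>!c :: nat \<Rightarrow> 'a.
        (\<forall>i\<ge>n. c i = 0) \<and> (\<lambda>x. f x - (\<Sum>i<n. c i * b i x)) \<in> W))"

definition max_ideal :: "'a::field point set \<Rightarrow> 'a point \<Rightarrow> 'a pfun set" where
  "max_ideal \<V> x = {f \<in> local_ring \<V> x. f x = 0}"

definition max_ideal_square :: "'a::field point set \<Rightarrow> 'a point \<Rightarrow> 'a pfun set" where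
  "max_ideal_square \<V> x = {f \<in> local_ring \<V> x. \<exists>(n::nat) a b.
     (\<forall>i<n. a i \<in> max_ideal \<V> x \<and> b i \<in> max_ideal \<V> x) \<and>
     generically_equal \<V> f (\<lambda>y. \<Sum>i<n. a i y * b i y)}"

definition smooth_of_dim :: "'a::field point set \<Rightarrow> nat \<Rightarrow> bool" where
  "smooth_of_dim \<V> n \<longleftrightarrow> has_dimension \<V> n \<and>
     (\<forall>x\<in>\<V>. has_quotient_dim (max_ideal \<V> x) (max_ideal_square \<V> x) n)"

definition tangent_vectors :: "'a::field point set \<Rightarrow> 'a point \<Rightarrow> ('a pfun \<Rightarrow> 'a) set" where
  "tangent_vectors \<V> x = {\<delta>. \<forall>f\<in>local_ring \<V> x. \<forall>g\<in>local_ring \<V> x.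
     \<delta> (\<lambda>y. f y + g y) = \<delta> f + \<delta> g \<and>
     (\<forall>c. \<delta> (\<lambda>y. c * f y) = c * \<delta> f) \<and>
     \<delta> (\<lambda>y. f y * g y) = f x * \<delta> g + g x * \<delta> f}"

text \<open>A regular 2-form is a family of alternating forms on the tangent spaces which is locally a
  finite sum of terms \<open>a db \<and> dc\<close> with \<open>a\<close>, \<open>b\<close>, \<open>c\<close> regular.\<close>

definition regular_two_form ::
    "'a::field point set \<Rightarrow> ('a point \<Rightarrow> ('a pfun \<Rightarrow> 'a) \<Rightarrow> ('a pfun \<Rightarrow> 'a) \<Rightarrow> 'a) \<Rightarrow> bool" where
  "regular_two_form \<V> \<omega> \<longleftrightarrow> (\<forall>x\<in>\<V>. \<exists>V (n::nat) a b c. x \<in> V \<and> zopen \<V> V \<and>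
     (\<forall>i<n. regular_on \<V> V (a i) \<and> regular_on \<V> V (b i) \<and> regular_on \<V> V (c i)) \<and>
     (\<forall>y\<in>V. \<forall>\<delta>\<in>tangent_vectors \<V> y. \<forall>\<epsilon>\<in>tangent_vectors \<V> y.
        \<omega> y \<delta> \<epsilon> = (\<Sum>i<n. a i y * (\<delta> (b i) * \<epsilon> (c i) - \<delta> (c i) * \<epsilon> (b i)))))"

text \<open>For a smooth surface the canonical bundle is trivial iff it has a nowhere vanishing
  section.\<close>

definition trivial_canonical_bundle :: "'a::field point set \<Rightarrow> bool" where
  "trivial_canonical_bundle \<V> \<longleftrightarrow> (\<exists>\<omega>. regular_two_form \<V> \<omega> \<and>
     (\<forall>x\<in>\<V>. \<exists>\<delta>\<in>tangent_vectors \<V> x. \<exists>\<epsilon>\<in>tangent_vectors \<V> x. \<omega> x \<delta> \<epsilon> \<noteq> 0))"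

text \<open>\<open>H\<^sup>1(\<V>, O\<^sub>\<V>) = 0\<close>. In degree one, Cech cohomology (the limit over open covers, where finite
  ones suffice) is sheaf cohomology, and the cohomology of every single cover injects into it.\<close>

definition H1_structure_sheaf_zero :: "'a::field point set \<Rightarrow> bool" where
  "H1_structure_sheaf_zero \<V> \<longleftrightarrow> (\<forall>(n::nat) U f.
     (\<forall>i<n. zopen \<V> (U i)) \<and> (\<Union>i<n. U i) = \<V> \<and>
     (\<forall>i<n. \<forall>j<n. regular_on \<V> (U i \<inter> U j) (f i j)) \<and>
     (\<forall>i<n. \<forall>j<n. \<forall>k<n. \<forall>x\<in>U i \<inter> U j \<inter> U k. f i j x + f j k x = f i k x) \<longrightarrow>
     (\<exists>g. (\<forall>i<n. regular_on \<V> (U i) (g i)) \<and>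
          (\<forall>i<n. \<forall>j<n. \<forall>x\<in>U i \<inter> U j. f i j x = g j x - g i x)))"

definition K3_surface :: "'a::field point set \<Rightarrow> bool" where
  "K3_surface \<V> \<longleftrightarrow> irreducible_closed \<V> \<V> \<and> smooth_of_dim \<V> 2 \<and>
     trivial_canonical_bundle \<V> \<and> H1_structure_sheaf_zero \<V>"


section \<open>Divisors and intersection numbers\<close>

text \<open>A Cartier divisor is a section of the sheaf of nonzero rational functions modulo units. It is
  given by the function sending a point to the set (a coset of the units of the local ring) of its
  local equations there. Only the values at points of \<open>\<V>\<close> matter.\<close>

type_synonym 'a divisor = "'a point \<Rightarrow> 'a pfun set"

definition principal_at :: "'a::field point set \<Rightarrow> 'a pfun \<Rightarrow> 'a divisor" where
  "principal_at \<V> f y =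
     {g. \<exists>u\<in>local_ring \<V> y. u y \<noteq> 0 \<and> generically_equal \<V> g (\<lambda>z. u z * f z)}"

definition cartier :: "'a::field point set \<Rightarrow> 'a divisor \<Rightarrow> bool" where
  "cartier \<V> D \<longleftrightarrow> (\<forall>x\<in>\<V>. \<exists>U f. zopen \<V> U \<and> x \<in> U \<and> nonzero_rational \<V> f \<and>
     (\<forall>y\<in>U. D y = principal_at \<V> f y))"

definition principal :: "'a::field point set \<Rightarrow> 'a divisor \<Rightarrow> bool" where
  "principal \<V> D \<longleftrightarrow> (\<exists>f. nonzero_rational \<V> f \<and> (\<forall>y\<in>\<V>. D y = principal_at \<V> f y))"

definition div_add :: "'a::field point set \<Rightarrow> 'a divisor \<Rightarrow> 'a divisor \<Rightarrow> 'a divisor" where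
  "div_add \<V> D E y = (\<Union>f\<in>D y. \<Union>g\<in>E y. principal_at \<V> (\<lambda>z. f z * g z) y)"

definition div_scale :: "'a::field point set \<Rightarrow> int \<Rightarrow> 'a divisor \<Rightarrow> 'a divisor" where
  "div_scale \<V> m D y = (\<Union>f\<in>D y. principal_at \<V> (\<lambda>z. f z powi m) y)"

definition lin_equiv :: "'a::field point set \<Rightarrow> 'a divisor \<Rightarrow> 'a divisor \<Rightarrow> bool" where
  "lin_equiv \<V> D E \<longleftrightarrow> principal \<V> (div_add \<V> D (div_scale \<V> (-1) E))"

definition div_pullback ::
    "'a::field point set \<Rightarrow> ('a point \<Rightarrow> 'a point) \<Rightarrow> 'a divisor \<Rightarrow> 'a divisor" where
  "div_pullback \<V> \<gamma> D y = {g. \<exists>f\<in>D (\<gamma> y). generically_equal \<V> g (f \<circ> \<gamma>)}"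

definition effective :: "'a::field point set \<Rightarrow> 'a divisor \<Rightarrow> bool" where
  "effective \<V> D \<longleftrightarrow> cartier \<V> D \<and> (\<forall>y\<in>\<V>. D y \<inter> local_ring \<V> y \<noteq> {})"

definition div_support :: "'a::field point set \<Rightarrow> 'a divisor \<Rightarrow> 'a point set" where
  "div_support \<V> D = {y \<in> \<V>. (\<lambda>_. 1) \<notin> D y}"

definition local_equations_ideal ::
    "'a::field point set \<Rightarrow> 'a divisor \<Rightarrow> 'a divisor \<Rightarrow> 'a point \<Rightarrow> 'a pfun set" where
  "local_equations_ideal \<V> D E y = {h \<in> local_ring \<V> y.
     \<exists>f\<in>D y \<inter> local_ring \<V> y. \<exists>g\<in>E y \<inter> local_ring \<V> y.
     \<exists>a\<in>local_ring \<V> y. \<exists>b\<in>local_ring \<V> y. generically_equal \<V> h (\<lambda>z. a z * f z + b z * g z)}"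

definition local_intersection ::
    "'a::field point set \<Rightarrow> 'a divisor \<Rightarrow> 'a divisor \<Rightarrow> 'a point \<Rightarrow> nat" where
  "local_intersection \<V> D E y =
     (THE n. has_quotient_dim (local_ring \<V> y) (local_equations_ideal \<V> D E y) n)"

definition meet_properly :: "'a::field point set \<Rightarrow> 'a divisor \<Rightarrow> 'a divisor \<Rightarrow> bool" where
  "meet_properly \<V> D E \<longleftrightarrow> finite (div_support \<V> D \<inter> div_support \<V> E)"

definition proper_intersection ::
    "'a::field point set \<Rightarrow> 'a divisor \<Rightarrow> 'a divisor \<Rightarrow> int" where
  "proper_intersection \<V> D E =
     (\<Sum>y\<in>div_support \<V> D \<inter> div_support \<V> E. int (local_intersection \<V> D E y))"

text \<open>The intersection number on a smooth projective surface: move both divisors within their linear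
  equivalence classes to differences of effective divisors without common components, and
  count intersection points with multiplicity.\<close>

definition intersection_number ::
    "'a::field point set \<Rightarrow> 'a divisor \<Rightarrow> 'a divisor \<Rightarrow> int" where
  "intersection_number \<V> D E = (THE n. \<exists>D1 D2 E1 E2.
     effective \<V> D1 \<and> effective \<V> D2 \<and> effective \<V> E1 \<and> effective \<V> E2 \<and>
     lin_equiv \<V> D (div_add \<V> D1 (div_scale \<V> (-1) D2)) \<and>
     lin_equiv \<V> E (div_add \<V> E1 (div_scale \<V> (-1) E2)) \<and>
     meet_properly \<V> D1 E1 \<and> meet_properly \<V> D1 E2 \<and>
     meet_properly \<V> D2 E1 \<and> meet_properly \<V> D2 E2 \<and>
     n = proper_intersection \<V> D1 E1 - proper_intersection \<V> D1 E2
       - proper_intersection \<V> D2 E1 + proper_intersection \<V> D2 E2)"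

definition ideal_of_subset :: "'a::field point set \<Rightarrow> 'a point set \<Rightarrow> 'a point \<Rightarrow> 'a pfun set" where
  "ideal_of_subset \<V> C y =
     {f. \<exists>U. y \<in> U \<and> regular_on \<V> U f \<and> (\<forall>z\<in>U \<inter> C. f z = 0)}"

definition divisor_of_curve :: "'a::field point set \<Rightarrow> 'a point set \<Rightarrow> 'a divisor \<Rightarrow> bool" where
  "divisor_of_curve \<V> C D \<longleftrightarrow> cartier \<V> D \<and> (\<forall>y\<in>\<V>. \<exists>f\<in>D y \<inter> local_ring \<V> y.
     ideal_of_subset \<V> C y =
       {g \<in> local_ring \<V> y. \<exists>a\<in>local_ring \<V> y. generically_equal \<V> g (\<lambda>z. a z * f z)})"

definition minus_two_curve :: "'a::field point set \<Rightarrow> 'a point set \<Rightarrow> bool" where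
  "minus_two_curve \<V> C \<longleftrightarrow> irreducible_closed \<V> C \<and> has_dimension C 1 \<and>
     (\<exists>D. divisor_of_curve \<V> C D \<and> intersection_number \<V> D D = -2)"

text \<open>\<open>sections_map \<V> D n s \<phi>\<close>: \<open>s 0, \<dots>, s n\<close> are global sections of \<open>O(D)\<close> without common
  zeros and \<open>\<phi>\<close> is the resulting morphism to projective \<open>n\<close>-space. A rational function \<open>s\<close> is a
  section of \<open>O(D)\<close> iff its products \<open>r\<close> with local equations of \<open>D\<close> are regular.\<close>

definition sections_map ::
    "'a::field point set \<Rightarrow> 'a divisor \<Rightarrow> nat \<Rightarrow> (nat \<Rightarrow> 'a pfun) \<Rightarrow>
     ('a point \<Rightarrow> 'a point) \<Rightarrow> bool" where
  "sections_map \<V> D n s \<phi> \<longleftrightarrow> (\<forall>x\<in>\<V>. \<exists>g\<in>D x. \<exists>r.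
     (\<forall>i\<le>n. r i \<in> local_ring \<V> x \<and> generically_equal \<V> (r i) (\<lambda>z. s i z * g z)) \<and>
     (\<exists>i\<le>n. r i x \<noteq> 0) \<and>
     \<phi> x = proj_point (\<lambda>i. if i \<le> n then r i x else 0))"

definition very_ample :: "'a::field point set \<Rightarrow> 'a divisor \<Rightarrow> bool" where
  "very_ample \<V> D \<longleftrightarrow> cartier \<V> D \<and> (\<exists>n s \<phi>. sections_map \<V> D n s \<phi> \<and>
     projective_set UNIV n (\<phi> ` \<V>) \<and> variety_iso \<V> (\<phi> ` \<V>) \<phi>)"

definition ample :: "'a::field point set \<Rightarrow> 'a divisor \<Rightarrow> bool" where
  "ample \<V> D \<longleftrightarrow> cartier \<V> D \<and> (\<exists>m>0. very_ample \<V> (div_scale \<V> m D))"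


section \<open>The Neron-Severi space\<close>

definition integral_vectors :: "(real ^ 'r) set" where
  "integral_vectors = {v. \<forall>i. v $ i \<in> \<int>}"

text \<open>For a K3 surface \<open>NS(\<V>) = Pic(\<V>)\<close> is free of finite rank. A marking is the class map of an
  isomorphism of the Picard group with the integral vectors, so \<open>CARD('r)\<close> is the Picard rank and
  \<open>real ^ 'r\<close> is \<open>NS(\<V>)\<close> with real coefficients.\<close>

definition NS_marking :: "'a::field point set \<Rightarrow> ('a divisor \<Rightarrow> real ^ 'r) \<Rightarrow> bool" where
  "NS_marking \<V> cls \<longleftrightarrow>
     (\<forall>D E. cartier \<V> D \<and> cartier \<V> E \<longrightarrow> cls (div_add \<V> D E) = cls D + cls E) \<and>
     (\<forall>D. cartier \<V> D \<longrightarrow> (cls D = 0 \<longleftrightarrow> principal \<V> D)) \<and>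
     cls ` {D. cartier \<V> D} = integral_vectors"

definition intersection_form ::
    "'a::field point set \<Rightarrow> ('a divisor \<Rightarrow> real ^ 'r) \<Rightarrow> (real ^ 'r \<Rightarrow> real ^ 'r \<Rightarrow> real) \<Rightarrow> bool" where
  "intersection_form \<V> cls Q \<longleftrightarrow> bilinear Q \<and>
     (\<forall>D E. cartier \<V> D \<and> cartier \<V> E \<longrightarrow>
        Q (cls D) (cls E) = of_int (intersection_number \<V> D E))"

definition ample_cone :: "'a::field point set \<Rightarrow> ('a divisor \<Rightarrow> real ^ 'r) \<Rightarrow> (real ^ 'r) set" where
  "ample_cone \<V> cls = {(\<Sum>i<n. c i *\<^sub>R cls (D i)) | (n::nat) c D.
     n > 0 \<and> (\<forall>i<n. c i > 0 \<and> ample \<V> (D i))}"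

definition NS_pullback ::
    "'a::field point set \<Rightarrow> ('a divisor \<Rightarrow> real ^ 'r) \<Rightarrow> ('a point \<Rightarrow> 'a point) \<Rightarrow>
     real ^ 'r \<Rightarrow> real ^ 'r" where
  "NS_pullback \<V> cls \<gamma> =
     (THE T. linear T \<and> (\<forall>D. cartier \<V> D \<longrightarrow> T (cls D) = cls (div_pullback \<V> \<gamma> D)))"


section \<open>The boundary of the ample cone and its blow-ups\<close>

text \<open>In this and the next section \<open>A\<close> is the ample cone and \<open>Q\<close> the intersection form.\<close>

definition cone_boundary :: "(real ^ 'r) set \<Rightarrow> (real ^ 'r) set" where
  "cone_boundary A = frontier A - {0}"

definition irrational_boundary :: "(real ^ 'r) set \<Rightarrow> (real ^ 'r) set" where
  "irrational_boundary A =
     {x \<in> cone_boundary A. \<not> (\<exists>c. c \<noteq> 0 \<and> (\<forall>i. (c *\<^sub>R x) $ i \<in> \<rat>))}"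

definition parabolic :: "(real ^ 'r) set \<Rightarrow> (real ^ 'r) set" where
  "parabolic A = {E \<in> cone_boundary A \<inter> integral_vectors.
     \<forall>w\<in>integral_vectors. \<forall>n::nat. E = real n *\<^sub>R w \<longrightarrow> n = 1}"

definition parabolic_upto ::
    "(real ^ 'r) set \<Rightarrow> (real ^ 'r \<Rightarrow> real ^ 'r \<Rightarrow> real) \<Rightarrow> real ^ 'r \<Rightarrow> real \<Rightarrow> (real ^ 'r) set" where
  "parabolic_upto A Q \<omega>0 R = {E \<in> parabolic A. Q \<omega>0 E \<le> R}"

text \<open>The projective space of \<open>NS / E\<close>: its points are the planes containing \<open>E\<close>, and it carries
  the quotient topology.\<close>

definition planes_topology :: "real ^ 'r \<Rightarrow> (real ^ 'r) set topology" where
  "planes_topology E = topology (\<lambda>S. S \<subseteq> {span {E, x} | x. x \<notin> span {E}} \<and>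
     open {x. x \<notin> span {E} \<and> span {E, x} \<in> S})"

lemma istopology_planes:
  fixes E :: "real ^ 'r"
  shows "istopology (\<lambda>S. S \<subseteq> {span {E, x} | x. x \<notin> span {E}} \<and>
     open {x. x \<notin> span {E} \<and> span {E, x} \<in> S})"
proof -
  have 1: "{x. x \<notin> span {E} \<and> span {E, x} \<in> S \<inter> T} =
      {x. x \<notin> span {E} \<and> span {E, x} \<in> S} \<inter> {x. x \<notin> span {E} \<and> span {E, x} \<in> T}"
    for S T :: "(real ^ 'r) set set" by auto
  have 2: "{x. x \<notin> span {E} \<and> span {E, x} \<in> \<Union>\<K>} =
      (\<Union>S\<in>\<K>. {x. x \<notin> span {E} \<and> span {E, x} \<in> S})"
    for \<K> :: "(real ^ 'r) set set set" by auto
  show ?thesis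
    unfolding istopology_def 1 2 by (intro conjI allI impI open_Int open_UN ballI) blast+
qed

text \<open>The real projective blow-up along the rays spanned by a finite set \<open>P\<close> of classes. Linear
  functionals vanishing on \<open>E\<close> generate the ideal of the ray of \<open>E\<close> in the boundary, hence the
  blow-up is the closure of the graph of the projections away from the classes in \<open>P\<close>. The fibre
  over a point of the ray of \<open>E\<close> consists of the planes containing \<open>E\<close> and contained in the
  orthogonal complement of \<open>E\<close>.\<close>

definition blowup :: "(real ^ 'r) set \<Rightarrow> (real ^ 'r) set \<Rightarrow>
    ((real ^ 'r) \<times> (real ^ 'r \<Rightarrow> (real ^ 'r) set)) topology" where
  "blowup A P =
     (let T = prod_topology (top_of_set (cone_boundary A)) (product_topology planes_topology P);
          G = {(x, \<lambda>E\<in>P. span {E, x}) | x. x \<in> cone_boundary A \<and> (\<forall>E\<in>P. x \<notin> span {E})}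
      in subtopology T (T closure_of G))"

text \<open>The projective limit over \<open>R\<close> of the blow-ups along the rays of \<open>parabolic_upto A Q \<omega>0 R\<close>.
  A compatible family of points in the stages amounts to one pair \<open>(x, L)\<close>, where \<open>L\<close> is defined
  on all parabolic classes and the stages see its restrictions. The topology is the coarsest one
  making the maps to all stages continuous.\<close>

type_synonym 'r boundary_point = "(real ^ 'r) \<times> (real ^ 'r \<Rightarrow> (real ^ 'r) set)"

definition to_stage :: "(real ^ 'r) set \<Rightarrow> 'r boundary_point \<Rightarrow> 'r boundary_point" where
  "to_stage P a = (fst a, restrict (snd a) P)"

definition enlarged_boundary ::
    "(real ^ 'r) set \<Rightarrow> (real ^ 'r \<Rightarrow> real ^ 'r \<Rightarrow> real) \<Rightarrow> real ^ 'r \<Rightarrow> 'r boundary_point set" where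
  "enlarged_boundary A Q \<omega>0 = {a. snd a \<in> extensional (parabolic A) \<and>
     (\<forall>R. to_stage (parabolic_upto A Q \<omega>0 R) a \<in> topspace (blowup A (parabolic_upto A Q \<omega>0 R)))}"

definition enlarged_boundary_topology ::
    "(real ^ 'r) set \<Rightarrow> (real ^ 'r \<Rightarrow> real ^ 'r \<Rightarrow> real) \<Rightarrow> real ^ 'r \<Rightarrow> 'r boundary_point topology" where
  "enlarged_boundary_topology A Q \<omega>0 = topology_generated_by
     {{a \<in> enlarged_boundary A Q \<omega>0. to_stage (parabolic_upto A Q \<omega>0 R) a \<in> S} | R S.
       openin (blowup A (parabolic_upto A Q \<omega>0 R)) S}"

definition boundary_scale :: "real \<Rightarrow> 'r::finite boundary_point \<Rightarrow> 'r boundary_point" where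
  "boundary_scale t a = (t *\<^sub>R fst a, snd a)"

definition boundary_map ::
    "(real ^ 'r) set \<Rightarrow> (real ^ 'r \<Rightarrow> real ^ 'r) \<Rightarrow> 'r boundary_point \<Rightarrow> 'r boundary_point" where
  "boundary_map A T a =
     (T (fst a), \<lambda>E\<in>parabolic A. T ` snd a (the_inv T E))"


section \<open>Natural volume\<close>

text \<open>The component of the classes of positive square that contains the ample cone.\<close>

definition positive_cone ::
    "(real ^ 'r) set \<Rightarrow> (real ^ 'r \<Rightarrow> real ^ 'r \<Rightarrow> real) \<Rightarrow> (real ^ 'r) set" where
  "positive_cone A Q = \<Union>{C \<in> components {v. Q v v > 0}. A \<subseteq> C}"

definition positive_isometries ::
    "(real ^ 'r) set \<Rightarrow> (real ^ 'r \<Rightarrow> real ^ 'r \<Rightarrow> real) \<Rightarrow> (real ^ 'r \<Rightarrow> real ^ 'r) set" where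
  "positive_isometries A Q = {T. linear T \<and> (\<forall>v w. Q (T v) (T w) = Q v w) \<and>
     T ` positive_cone A Q = positive_cone A Q}"

text \<open>The nonzero invariant Radon measures on the boundary; they are unique up to scaling.\<close>

definition natural_measure ::
    "(real ^ 'r) set \<Rightarrow> (real ^ 'r \<Rightarrow> real ^ 'r \<Rightarrow> real) \<Rightarrow> (real ^ 'r) measure \<Rightarrow> bool" where
  "natural_measure A Q \<mu> \<longleftrightarrow>
     sets \<mu> = sets (restrict_space borel (cone_boundary A)) \<and>
     emeasure \<mu> (cone_boundary A) \<noteq> 0 \<and>
     (\<forall>K. compact K \<and> K \<subseteq> cone_boundary A \<longrightarrow> emeasure \<mu> K < \<infinity>) \<and>
     (\<forall>T\<in>positive_isometries A Q. \<forall>B\<in>sets \<mu>. emeasure \<mu> (T ` B) = emeasure \<mu> B)"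

definition natural_volume ::
    "(real ^ 'r) set \<Rightarrow> (real ^ 'r) measure \<Rightarrow> 'r boundary_point set \<Rightarrow> ennreal" where
  "natural_volume A \<mu> S = emeasure \<mu> (fst ` S \<inter> irrational_boundary A)"


section \<open>Canonical heights\<close>

definition point_height :: "'a::field_char_0 point \<Rightarrow> real" where
  "point_height x = vector_height (SOME v. v \<in> x)"

text \<open>\<open>f\<close> differs by a bounded function from a real combination of Weil heights for base point free
  divisors, whose classes combine to \<open>a\<close>.\<close>

definition height_for_class ::
    "'a::field_char_0 point set \<Rightarrow> ('a divisor \<Rightarrow> real ^ 'r) \<Rightarrow> real ^ 'r \<Rightarrow> ('a point \<Rightarrow> real) \<Rightarrow>
     bool" where
  "height_for_class \<V> cls a f \<longleftrightarrow> (\<exists>(n::nat) c D M s \<phi>.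
     (\<forall>i<n. cartier \<V> (D i) \<and> sections_map \<V> (D i) (M i) (s i) (\<phi> i)) \<and>
     a = (\<Sum>i<n. c i *\<^sub>R cls (D i)) \<and>
     (\<exists>B. \<forall>x\<in>\<V>. \<bar>f x - (\<Sum>i<n. c i * point_height (\<phi> i x))\<bar> \<le> B))"

definition canonical_height ::
    "'a::field_char_0 point set \<Rightarrow> ('a divisor \<Rightarrow> real ^ 'r) \<Rightarrow>
     (real ^ 'r \<Rightarrow> real ^ 'r \<Rightarrow> real) \<Rightarrow> real ^ 'r \<Rightarrow>
     ('r boundary_point \<Rightarrow> 'a point \<Rightarrow> real) \<Rightarrow> bool" where
  "canonical_height \<V> cls Q \<omega>0 h \<longleftrightarrow>
     (let A = ample_cone \<V> cls; \<B> = enlarged_boundary A Q \<omega>0 in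
       (\<forall>a\<in>\<B>. height_for_class \<V> cls (fst a) (h a)) \<and>
       (\<forall>\<gamma>\<in>automorphisms \<V>. \<forall>a\<in>\<B>. \<forall>p\<in>\<V>.
          h a (\<gamma> p) = h (boundary_map A (NS_pullback \<V> cls \<gamma>) a) p) \<and>
       (\<forall>p\<in>\<V>. (\<forall>a\<in>\<B>. h a p \<ge> 0) \<and>
          continuous_map (enlarged_boundary_topology A Q \<omega>0) euclideanreal (\<lambda>a. h a p) \<and>
          (\<forall>a\<in>\<B>. \<forall>t>0. h (boundary_scale t a) p = t * h a p)))"

end

theory Submission
  imports Defs
begin

text \<open>The volume is constant because an automorphism \<open>\<gamma>\<close> acts on the real Neron-Severi space by an
  isometry \<open>\<gamma>\<^sup>*\<close> that preserves the ample cone, and equivariance of the canonical heights says that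
  this isometry carries the sublevel set of \<open>\<gamma> p\<close> onto that of \<open>p\<close>. The natural measure is invariant
  under such isometries. So \<open>p\<close> and \<open>\<gamma> p\<close> have sublevel sets of the same volume. Three things have
  to be checked.

  First, \<open>\<gamma>\<^sup>*\<close> really is an isometry that preserves the integral classes and the ample cone. This is
  transport of structure: precomposition with \<open>\<gamma>\<close> respects open sets and regular functions, and
  intersection numbers and ampleness are built from nothing else. To make this literal, \<open>\<gamma>\<close> is
  extended to a bijection of all points, so that every quantifier over functions, divisors or open
  sets can be reindexed (\<open>intersection_number_pull\<close>, \<open>ample_pull\<close>). Geometry enters only when
  classes are compared: on an irreducible set two nonempty open sets meet, so generic equality is
  transitive. This makes sums of Cartier divisors Cartier and identifies the exact transport of a
  Cartier divisor with its pullback, whence the linear action (\<open>NS_action\<close>).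

  Secondly, the sublevel sets live on the enlarged boundary, whereas the measure sees only the
  irrational classes. Over an irrational class \<open>x\<close> there is exactly one point of the enlarged
  boundary, namely \<open>x\<close> with the planes spanned by \<open>x\<close> and each parabolic class: no ray that is blown
  up passes through \<open>x\<close>, and spaces of planes are Hausdorff
  (\<open>enlarged_boundary_over_irrational\<close>). Hence it suffices to follow these points under \<open>\<gamma>\<^sup>*\<close>, which
  need not respect the filtration of the parabolic classes by their degrees.

  Finally, \<open>\<gamma>\<^sup>*\<close> preserves the positive cone, since it permutes the components of the classes of
  positive square and fixes the ample cone (\<open>positive_isometry\<close>). It is a homeomorphism of the
  boundary, so a set is measurable if and only if its image is
  (\<open>natural_measure_image\<close>); by convention a set that is not measurable has volume zero, and so
  has its image.\<close>

section \<open>Homogeneous polynomials and the Zariski topology\<close>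

definition monomial_value :: "(nat \<Rightarrow>\<^sub>0 nat) \<Rightarrow> (nat \<Rightarrow> 'a::field) \<Rightarrow> 'a" where
  "monomial_value m v = (\<Prod>i\<in>Poly_Mapping.keys m. v i ^ Poly_Mapping.lookup m i)"

definition monomial_degree :: "(nat \<Rightarrow>\<^sub>0 nat) \<Rightarrow> nat" where
  "monomial_degree m = (\<Sum>i\<in>Poly_Mapping.keys m. Poly_Mapping.lookup m i)"

lemma monomial_value_superset:
  assumes "finite K" "Poly_Mapping.keys m \<subseteq> K"
  shows "monomial_value m v = (\<Prod>i\<in>K. v i ^ Poly_Mapping.lookup m i)"
  unfolding monomial_value_def using assms
  by (intro prod.mono_neutral_left) (auto simp: in_keys_iff)

lemma monomial_degree_superset:
  assumes "finite K" "Poly_Mapping.keys m \<subseteq> K"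
  shows "monomial_degree m = (\<Sum>i\<in>K. Poly_Mapping.lookup m i)"
  unfolding monomial_degree_def using assms
  by (intro sum.mono_neutral_left) (auto simp: in_keys_iff)

lemma monomial_value_add:
  "monomial_value (m + n) v = monomial_value m v * monomial_value n v"
proof -
  let ?K = "Poly_Mapping.keys m \<union> Poly_Mapping.keys n"
  have "Poly_Mapping.keys (m + n) \<subseteq> ?K" by (rule keys_add)
  then show ?thesis
    by (simp add: monomial_value_superset[where K = ?K] lookup_add power_add prod.distrib)
qed

lemma monomial_degree_add:
  "monomial_degree (m + n) = monomial_degree m + monomial_degree n"
proof -
  let ?K = "Poly_Mapping.keys m \<union> Poly_Mapping.keys n"
  have "Poly_Mapping.keys (m + n) \<subseteq> ?K" by (rule keys_add)
  then show ?thesis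
    by (simp add: monomial_degree_superset[where K = ?K] lookup_add sum.distrib)
qed

lemma monomial_value_scale:
  "monomial_value m (\<lambda>i. c * v i) = c ^ monomial_degree m * monomial_value m v"
  by (simp add: monomial_value_def monomial_degree_def power_mult_distrib prod.distrib power_sum)

lemma mpoly_eval_superset:
  assumes "finite K" "Poly_Mapping.keys p \<subseteq> K"
  shows "mpoly_eval p v = (\<Sum>m\<in>K. Poly_Mapping.lookup p m * monomial_value m v)"
  unfolding mpoly_eval_def monomial_value_def using assms
  by (intro sum.mono_neutral_left) (auto simp: in_keys_iff)

lemma mpoly_eval_single:
  "mpoly_eval (Poly_Mapping.single m c) v = c * monomial_value m v"
  by (subst mpoly_eval_superset[where K = "{m}"]) (auto simp: lookup_single)

lemma mpoly_eval_add: "mpoly_eval (p + q) v = mpoly_eval p v + mpoly_eval q v"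
proof -
  let ?K = "Poly_Mapping.keys p \<union> Poly_Mapping.keys q"
  have "Poly_Mapping.keys (p + q) \<subseteq> ?K" by (rule keys_add)
  then show ?thesis
    by (simp add: mpoly_eval_superset[where K = ?K] lookup_add distrib_right sum.distrib)
qed

lemma mpoly_eval_sum: "mpoly_eval (\<Sum>i\<in>I. p i) v = (\<Sum>i\<in>I. mpoly_eval (p i) v)"
proof (induction I rule: infinite_finite_induct)
  case (insert x F)
  then show ?case by (simp add: mpoly_eval_add)
qed (simp_all add: mpoly_eval_def)

lemma sum_of_terms:
  "(\<Sum>m\<in>Poly_Mapping.keys p. Poly_Mapping.single m (Poly_Mapping.lookup p m)) = p"
proof (rule poly_mapping_eqI)
  fix k
  have "(\<Sum>m\<in>Poly_Mapping.keys p. Poly_Mapping.lookup p m when m = k) = Poly_Mapping.lookup p k"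
    by (cases "k \<in> Poly_Mapping.keys p") (auto simp: when_def in_keys_iff)
  then show "Poly_Mapping.lookup (\<Sum>m\<in>Poly_Mapping.keys p.
      Poly_Mapping.single m (Poly_Mapping.lookup p m)) k = Poly_Mapping.lookup p k"
    by (simp add: lookup_sum lookup_single)
qed

lemma mpoly_eval_mult: "mpoly_eval (p * q) v = mpoly_eval p v * mpoly_eval q v"
proof -
  let ?t = "\<lambda>r m. Poly_Mapping.single m (Poly_Mapping.lookup r m)"
  have "p * q = (\<Sum>m\<in>Poly_Mapping.keys p. ?t p m) * (\<Sum>n\<in>Poly_Mapping.keys q. ?t q n)"
    by (simp only: sum_of_terms)
  also have "\<dots> = (\<Sum>m\<in>Poly_Mapping.keys p. \<Sum>n\<in>Poly_Mapping.keys q.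
      Poly_Mapping.single (m + n) (Poly_Mapping.lookup p m * Poly_Mapping.lookup q n))"
    by (simp add: sum_product mult_single)
  finally have "mpoly_eval (p * q) v = (\<Sum>m\<in>Poly_Mapping.keys p. \<Sum>n\<in>Poly_Mapping.keys q.
      (Poly_Mapping.lookup p m * monomial_value m v) * (Poly_Mapping.lookup q n * monomial_value n v))"
    by (simp add: mpoly_eval_sum mpoly_eval_single monomial_value_add mult_ac)
  then show ?thesis
    by (simp add: sum_product mpoly_eval_def monomial_value_def)
qed

lemma mpoly_eval_one: "mpoly_eval 1 v = 1"
  using mpoly_eval_single[of 0 1 v] by (simp add: monomial_value_def)

lemma homogeneous_alt:
  "homogeneous d p \<longleftrightarrow> (\<forall>m\<in>Poly_Mapping.keys p. monomial_degree m = d)"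
  by (simp add: homogeneous_def monomial_degree_def)

lemma homogeneous_one: "homogeneous 0 1"
  by (simp add: homogeneous_def)

lemma homogeneous_mult:
  assumes "homogeneous d p" "homogeneous e q"
  shows "homogeneous (d + e) (p * q)"
  unfolding homogeneous_alt
proof
  fix m assume "m \<in> Poly_Mapping.keys (p * q)"
  then obtain a b where "m = a + b" "a \<in> Poly_Mapping.keys p" "b \<in> Poly_Mapping.keys q"
    using keys_mult[of p q] by blast
  then show "monomial_degree m = d + e"
    using assms by (simp add: homogeneous_alt monomial_degree_add)
qed

lemma mpoly_eval_scale:
  assumes "homogeneous d p"
  shows "mpoly_eval p (\<lambda>i. c * v i) = c ^ d * mpoly_eval p v"
proof -
  have "mpoly_eval p w = (\<Sum>m\<in>Poly_Mapping.keys p. Poly_Mapping.lookup p m * monomial_value m w)"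
    for w by (simp add: mpoly_eval_def monomial_value_def)
  then show ?thesis using assms
    by (simp add: monomial_value_scale homogeneous_alt sum_distrib_left mult_ac)
qed

text \<open>Homogeneity makes vanishing independent of the coordinate vector. Without it, two polynomials
  could be nonzero at different representatives of a point, and products could not be used to
  intersect open sets.\<close>

lemma vanishes_iff:
  assumes "x \<in> proj_space N" "homogeneous d p" "v \<in> x"
  shows "vanishes p x \<longleftrightarrow> mpoly_eval p v = 0"
proof -
  obtain w where x: "x = proj_point w" using assms(1) by (auto simp: proj_space_def)
  obtain b where b: "b \<noteq> 0" "v = (\<lambda>i. b * w i)" using assms(3) x by (auto simp: proj_point_def)
  show ?thesis
    using b mpoly_eval_scale[OF assms(2)] by (auto simp: vanishes_def x proj_point_def)
qed

lemma proj_space_nonempty: "x \<in> proj_space N \<Longrightarrow> \<exists>v. v \<in> x"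
proof -
  assume "x \<in> proj_space N"
  then obtain w where "x = proj_point w" by (auto simp: proj_space_def)
  then have "w \<in> x" by (auto simp: proj_point_def intro!: exI[of _ 1])
  then show ?thesis by blast
qed

lemma vanishes_mult:
  assumes "x \<in> proj_space N" "homogeneous d p" "homogeneous e q"
  shows "vanishes (p * q) x \<longleftrightarrow> vanishes p x \<or> vanishes q x"
proof -
  obtain v where "v \<in> x" using proj_space_nonempty[OF assms(1)] by blast
  then show ?thesis
    using vanishes_iff[OF assms(1)] assms(2,3) homogeneous_mult[OF assms(2,3)]
    by (simp add: mpoly_eval_mult)
qed

lemma zopen_subset: "zopen \<V> U \<Longrightarrow> U \<subseteq> \<V>"
  by (auto simp: zopen_def)

lemma zopen_Int:
  assumes "\<V> \<subseteq> proj_space N" "zopen \<V> U" "zopen \<V> W"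
  shows "zopen \<V> (U \<inter> W)"
proof -
  obtain S where S: "\<forall>p\<in>S. \<exists>d. homogeneous d p" "U = {x \<in> \<V>. \<exists>p\<in>S. \<not> vanishes p x}"
    using assms(2) unfolding zopen_def by blast
  obtain R where R: "\<forall>p\<in>R. \<exists>d. homogeneous d p" "W = {x \<in> \<V>. \<exists>p\<in>R. \<not> vanishes p x}"
    using assms(3) unfolding zopen_def by blast
  have "vanishes (p * q) x \<longleftrightarrow> vanishes p x \<or> vanishes q x"
    if "x \<in> \<V>" "p \<in> S" "q \<in> R" for x p q
    using that S(1) R(1) assms(1) vanishes_mult by (metis subsetD)
  then have "U \<inter> W = {x \<in> \<V>. \<exists>p\<in>{p * q | p q. p \<in> S \<and> q \<in> R}. \<not> vanishes p x}"
    unfolding S(2) R(2) by blast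
  moreover have "\<forall>p\<in>{p * q | p q. p \<in> S \<and> q \<in> R}. \<exists>d. homogeneous d p"
    using S(1) R(1) homogeneous_mult by blast
  ultimately show ?thesis unfolding zopen_def by blast
qed

lemma zopen_whole:
  assumes "\<V> \<subseteq> proj_space N"
  shows "zopen \<V> \<V>"
  unfolding zopen_def
proof (intro exI[of _ "{1}"] conjI)
  show "\<forall>p\<in>{1}. \<exists>d. homogeneous d p" using homogeneous_one by blast
  show "\<V> = {x \<in> \<V>. \<exists>p\<in>{1}. \<not> vanishes p x}"
    using assms proj_space_nonempty by (auto simp: vanishes_def mpoly_eval_one subset_iff)
qed

lemma regular_on_zopen: "regular_on \<V> U f \<Longrightarrow> zopen \<V> U"
  by (simp add: regular_on_def)

lemma regular_on_quotient:
  assumes "regular_on \<V> U f" "x \<in> U"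
  obtains W a b d where "zopen \<V> W" "x \<in> W" "W \<subseteq> U" "homogeneous d a" "homogeneous d b"
    "\<forall>y\<in>W. \<forall>v\<in>y. mpoly_eval b v \<noteq> 0 \<and> f y = mpoly_eval a v / mpoly_eval b v"
proof -
  have "\<exists>W a b d. zopen \<V> W \<and> x \<in> W \<and> W \<subseteq> U \<and> homogeneous d a \<and> homogeneous d b \<and>
      (\<forall>y\<in>W. \<forall>v\<in>y. mpoly_eval b v \<noteq> 0 \<and> f y = mpoly_eval a v / mpoly_eval b v)"
    using bspec[OF conjunct2[OF assms(1)[unfolded regular_on_def]] assms(2)] .
  then show ?thesis
    by (elim exE conjE) (rule that, assumption+)
qed

lemma regular_onI:
  assumes "zopen \<V> U"
    and "\<And>x. x \<in> U \<Longrightarrow> \<exists>W a b d. zopen \<V> W \<and> x \<in> W \<and> W \<subseteq> U \<and> homogeneous d a \<and>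
      homogeneous d b \<and>
      (\<forall>y\<in>W. \<forall>v\<in>y. mpoly_eval b v \<noteq> 0 \<and> f y = mpoly_eval a v / mpoly_eval b v)"
  shows "regular_on \<V> U f"
  unfolding regular_on_def using assms by (intro conjI ballI)

lemma regular_on_cong:
  assumes "\<And>x. x \<in> U \<Longrightarrow> f x = g x"
  shows "regular_on \<V> U f \<longleftrightarrow> regular_on \<V> U g"
proof -
  have "regular_on \<V> U g" if f: "regular_on \<V> U f" and fg: "\<And>x. x \<in> U \<Longrightarrow> f x = g x" for f g
  proof (rule regular_onI)
    show "zopen \<V> U" using f by (rule regular_on_zopen)
    fix x assume "x \<in> U"
    obtain W a b d where W: "zopen \<V> W" "x \<in> W" "W \<subseteq> U" "homogeneous d a" "homogeneous d b"
      "\<forall>y\<in>W. \<forall>v\<in>y. mpoly_eval b v \<noteq> 0 \<and> f y = mpoly_eval a v / mpoly_eval b v"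
      by (rule regular_on_quotient[OF f \<open>x \<in> U\<close>]) (rule that, assumption+)
    show "\<exists>W a b d. zopen \<V> W \<and> x \<in> W \<and> W \<subseteq> U \<and> homogeneous d a \<and> homogeneous d b \<and>
        (\<forall>y\<in>W. \<forall>v\<in>y. mpoly_eval b v \<noteq> 0 \<and> g y = mpoly_eval a v / mpoly_eval b v)"
      using W fg by (intro exI[of _ W] exI[of _ a] exI[of _ b] exI[of _ d]) (simp add: subset_iff)
  qed
  then show ?thesis using assms by metis
qed

lemma regular_on_one:
  assumes "\<V> \<subseteq> proj_space N"
  shows "regular_on \<V> \<V> (\<lambda>_. 1)"
proof (rule regular_onI)
  show V: "zopen \<V> \<V>" using assms by (rule zopen_whole)
  show "\<exists>W a b d. zopen \<V> W \<and> x \<in> W \<and> W \<subseteq> \<V> \<and> homogeneous d a \<and> homogeneous d b \<and>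
      (\<forall>y\<in>W. \<forall>v\<in>y. mpoly_eval b v \<noteq> 0 \<and> 1 = mpoly_eval a v / mpoly_eval b v)" if "x \<in> \<V>" for x
    using that V homogeneous_one
    by (intro exI[of _ \<V>] exI[of _ 1] exI[of _ 0]) (auto simp: mpoly_eval_one)
qed

lemma regular_on_mult:
  assumes V: "\<V> \<subseteq> proj_space N" and f: "regular_on \<V> U f" and g: "regular_on \<V> W g"
  shows "regular_on \<V> (U \<inter> W) (\<lambda>x. f x * g x)"
proof (rule regular_onI)
  show "zopen \<V> (U \<inter> W)" using zopen_Int[OF V] regular_on_zopen[OF f] regular_on_zopen[OF g] .
  fix x assume x: "x \<in> U \<inter> W"
  obtain A a b d where A: "zopen \<V> A" "x \<in> A" "A \<subseteq> U" "homogeneous d a" "homogeneous d b"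
    "\<forall>y\<in>A. \<forall>v\<in>y. mpoly_eval b v \<noteq> 0 \<and> f y = mpoly_eval a v / mpoly_eval b v"
    by (rule regular_on_quotient[OF f IntD1[OF x]]) (rule that, assumption+)
  obtain B a' b' d' where B: "zopen \<V> B" "x \<in> B" "B \<subseteq> W" "homogeneous d' a'" "homogeneous d' b'"
    "\<forall>y\<in>B. \<forall>v\<in>y. mpoly_eval b' v \<noteq> 0 \<and> g y = mpoly_eval a' v / mpoly_eval b' v"
    by (rule regular_on_quotient[OF g IntD2[OF x]]) (rule that, assumption+)
  show "\<exists>C p q e. zopen \<V> C \<and> x \<in> C \<and> C \<subseteq> U \<inter> W \<and> homogeneous e p \<and> homogeneous e q \<and>
      (\<forall>y\<in>C. \<forall>v\<in>y. mpoly_eval q v \<noteq> 0 \<and> f y * g y = mpoly_eval p v / mpoly_eval q v)"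
  proof (intro exI conjI)
    show "zopen \<V> (A \<inter> B)" using zopen_Int[OF V A(1) B(1)] .
    show "homogeneous (d + d') (a * a')" "homogeneous (d + d') (b * b')"
      by (rule homogeneous_mult[OF A(4) B(4)], rule homogeneous_mult[OF A(5) B(5)])
    show "\<forall>y\<in>A \<inter> B. \<forall>v\<in>y. mpoly_eval (b * b') v \<noteq> 0 \<and>
        f y * g y = mpoly_eval (a * a') v / mpoly_eval (b * b') v"
      using A(6) B(6) by (fastforce simp: mpoly_eval_mult)
  qed (use A B in auto)
qed

section \<open>Generic equality and Cartier divisors on an irreducible set\<close>

locale irreducible_projective =
  fixes \<V> :: "'a::field point set" and N :: nat
  assumes proj: "\<V> \<subseteq> proj_space N" and irreducible: "irreducible_closed \<V> \<V>"
begin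

lemma nonempty: "\<V> \<noteq> {}"
  using irreducible by (simp add: irreducible_closed_def)

text \<open>Otherwise the complements would be two proper closed subsets that cover the whole set.\<close>

lemma zopen_Int_nonempty:
  assumes "zopen \<V> U" "zopen \<V> W" "U \<noteq> {}" "W \<noteq> {}"
  shows "U \<inter> W \<noteq> {}"
proof
  assume "U \<inter> W = {}"
  moreover have "U \<subseteq> \<V>" "W \<subseteq> \<V>" using assms zopen_subset by blast+
  ultimately have "zclosed \<V> (\<V> - U)" "zclosed \<V> (\<V> - W)" "\<V> = (\<V> - U) \<union> (\<V> - W)"
    using assms by (auto simp: zclosed_def double_diff)
  then have "\<V> = \<V> - U \<or> \<V> = \<V> - W"
    using irreducible unfolding irreducible_closed_def by blast
  then show False using \<open>U \<subseteq> \<V>\<close> \<open>W \<subseteq> \<V>\<close> assms(3,4) by blast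
qed

lemma generically_equalI: "(\<And>x. x \<in> \<V> \<Longrightarrow> f x = g x) \<Longrightarrow> generically_equal \<V> f g"
  unfolding generically_equal_def using zopen_whole[OF proj] nonempty by blast

lemma generically_equal_sym: "generically_equal \<V> f g \<Longrightarrow> generically_equal \<V> g f"
  unfolding generically_equal_def by metis

text \<open>Two generic equalities hold simultaneously on a nonempty open set. Every congruence property
  of generic equality that is used below is an instance.\<close>

lemma generically_equal_common:
  assumes "generically_equal \<V> f g" "generically_equal \<V> f' g'"
    and "\<And>x. f x = g x \<Longrightarrow> f' x = g' x \<Longrightarrow> h x = h' x"
  shows "generically_equal \<V> h h'"
proof -
  obtain U where U: "zopen \<V> U" "U \<noteq> {}" "\<forall>x\<in>U. f x = g x"
    using assms(1) unfolding generically_equal_def by blast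
  obtain W where W: "zopen \<V> W" "W \<noteq> {}" "\<forall>x\<in>W. f' x = g' x"
    using assms(2) unfolding generically_equal_def by blast
  have "\<forall>x\<in>U \<inter> W. h x = h' x" using U W assms(3) by blast
  then show ?thesis unfolding generically_equal_def
    using zopen_Int[OF proj U(1) W(1)] zopen_Int_nonempty[OF U(1) W(1) U(2) W(2)] by blast
qed

lemma generically_equal_trans:
  "generically_equal \<V> f g \<Longrightarrow> generically_equal \<V> g h \<Longrightarrow> generically_equal \<V> f h"
  by (rule generically_equal_common[where f = f and g = g and f' = g and g' = h]) auto

lemma local_ring_one: "x \<in> \<V> \<Longrightarrow> (\<lambda>_. 1) \<in> local_ring \<V> x"
  unfolding local_ring_def using regular_on_one[OF proj] by blast

lemma local_ring_mult:
  "f \<in> local_ring \<V> x \<Longrightarrow> g \<in> local_ring \<V> x \<Longrightarrow> (\<lambda>y. f y * g y) \<in> local_ring \<V> x"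
proof -
  assume "f \<in> local_ring \<V> x" "g \<in> local_ring \<V> x"
  then obtain U W where "x \<in> U" "regular_on \<V> U f" "x \<in> W" "regular_on \<V> W g"
    unfolding local_ring_def by blast
  then show ?thesis
    unfolding local_ring_def using regular_on_mult[OF proj, of U f W g] by blast
qed

lemma principal_at_saturated:
  "g \<in> principal_at \<V> f y \<Longrightarrow> generically_equal \<V> k g \<Longrightarrow> k \<in> principal_at \<V> f y"
  unfolding principal_at_def using generically_equal_trans by blast

lemma principal_at_self: "y \<in> \<V> \<Longrightarrow> f \<in> principal_at \<V> f y"
  unfolding principal_at_def using local_ring_one generically_equalI
  by (auto intro!: bexI[of _ "\<lambda>_. 1"])

text \<open>The unit factors of the two local equations multiply to a unit factor of the product.\<close>

lemma principal_at_mult: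
  assumes "y \<in> \<V>"
  shows "(\<Union>a\<in>principal_at \<V> f y. \<Union>b\<in>principal_at \<V> g y. principal_at \<V> (\<lambda>z. a z * b z) y) =
    principal_at \<V> (\<lambda>z. f z * g z) y" (is "?L = ?R")
proof
  show "?R \<subseteq> ?L" using principal_at_self[OF assms] by blast
  show "?L \<subseteq> ?R"
  proof
    fix k assume "k \<in> ?L"
    then obtain a b u v w where
      u: "u \<in> local_ring \<V> y" "u y \<noteq> 0" "generically_equal \<V> a (\<lambda>z. u z * f z)" and
      v: "v \<in> local_ring \<V> y" "v y \<noteq> 0" "generically_equal \<V> b (\<lambda>z. v z * g z)" and
      w: "w \<in> local_ring \<V> y" "w y \<noteq> 0" "generically_equal \<V> k (\<lambda>z. w z * (a z * b z))"
      unfolding principal_at_def by blast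
    have "generically_equal \<V> (\<lambda>z. w z * (a z * b z)) (\<lambda>z. (w z * (u z * v z)) * (f z * g z))"
      by (rule generically_equal_common[OF u(3) v(3)]) simp
    then have "generically_equal \<V> k (\<lambda>z. (w z * (u z * v z)) * (f z * g z))"
      using w(3) generically_equal_trans by blast
    moreover have "(\<lambda>z. w z * (u z * v z)) \<in> local_ring \<V> y"
      using u v w local_ring_mult by blast
    ultimately show "k \<in> ?R" unfolding principal_at_def using u(2) v(2) w(2)
      by (auto intro!: bexI[of _ "\<lambda>z. w z * (u z * v z)"])
  qed
qed

lemma nonzero_rational_mult:
  assumes "nonzero_rational \<V> f" "nonzero_rational \<V> g"
  shows "nonzero_rational \<V> (\<lambda>z. f z * g z)"
proof -
  obtain U W where U: "U \<noteq> {}" "regular_on \<V> U f" "\<forall>x\<in>U. f x \<noteq> 0"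
    and W: "W \<noteq> {}" "regular_on \<V> W g" "\<forall>x\<in>W. g x \<noteq> 0"
    using assms unfolding nonzero_rational_def by blast
  have "U \<inter> W \<noteq> {}" using U W zopen_Int_nonempty regular_on_zopen by metis
  then show ?thesis unfolding nonzero_rational_def
    using regular_on_mult[OF proj U(2) W(2)] U(3) W(3)
    by (intro exI[of _ "U \<inter> W"]) auto
qed

lemma cartier_div_add:
  assumes "cartier \<V> D" "cartier \<V> E"
  shows "cartier \<V> (div_add \<V> D E)"
  unfolding cartier_def
proof
  fix x assume x: "x \<in> \<V>"
  obtain U f where U: "zopen \<V> U" "x \<in> U" "nonzero_rational \<V> f" "\<forall>y\<in>U. D y = principal_at \<V> f y"
    using assms(1) x unfolding cartier_def by blast
  obtain W g where W: "zopen \<V> W" "x \<in> W" "nonzero_rational \<V> g" "\<forall>y\<in>W. E y = principal_at \<V> g y"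
    using assms(2) x unfolding cartier_def by blast
  have "\<forall>y\<in>U \<inter> W. div_add \<V> D E y = principal_at \<V> (\<lambda>z. f z * g z) y"
  proof
    fix y assume "y \<in> U \<inter> W"
    then have "D y = principal_at \<V> f y" "E y = principal_at \<V> g y" "y \<in> \<V>"
      using U(4) W(4) zopen_subset[OF U(1)] by auto
    then show "div_add \<V> D E y = principal_at \<V> (\<lambda>z. f z * g z) y"
      by (simp only: div_add_def principal_at_mult)
  qed
  then show "\<exists>U f. zopen \<V> U \<and> x \<in> U \<and> nonzero_rational \<V> f \<and>
      (\<forall>y\<in>U. div_add \<V> D E y = principal_at \<V> f y)"
    using zopen_Int[OF proj U(1) W(1)] nonzero_rational_mult[OF U(3) W(3)] U(2) W(2) by blast
qed

text \<open>Local equations count only up to generic equality; this makes the pullback of a Cartier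
  divisor, which contains everything generically equal to a pulled back equation, no larger than the
  exact transport.\<close>

lemma cartier_saturated:
  assumes "cartier \<V> D" "y \<in> \<V>" "g \<in> D y" "generically_equal \<V> k g"
  shows "k \<in> D y"
proof -
  obtain f where "D y = principal_at \<V> f y" using assms(1,2) unfolding cartier_def by blast
  then show ?thesis using assms(3,4) principal_at_saturated by blast
qed

end

lemma cartier_cong:
  assumes "\<And>y. y \<in> \<V> \<Longrightarrow> D y = E y"
  shows "cartier \<V> D \<longleftrightarrow> cartier \<V> E"
proof -
  have "cartier \<V> E" if D: "cartier \<V> D" and DE: "\<And>y. y \<in> \<V> \<Longrightarrow> D y = E y" for D E
    unfolding cartier_def
  proof
    fix x assume "x \<in> \<V>"
    then obtain U f where U: "zopen \<V> U" "x \<in> U" "nonzero_rational \<V> f" "\<forall>y\<in>U. D y = principal_at \<V> f y"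
      using D unfolding cartier_def by blast
    then have "\<forall>y\<in>U. E y = principal_at \<V> f y" using DE zopen_subset by (metis subsetD)
    then show "\<exists>U f. zopen \<V> U \<and> x \<in> U \<and> nonzero_rational \<V> f \<and> (\<forall>y\<in>U. E y = principal_at \<V> f y)"
      using U by blast
  qed
  then show ?thesis using assms by metis
qed

section \<open>Transport of structure along an automorphism\<close>

text \<open>In this section \<open>\<sigma>\<close> permutes all points and not only those of \<open>\<V>\<close>. Then precomposition with \<open>\<sigma>\<close> is a
  bijection on functions, on divisors and on sets, and each notion is transported by reindexing the
  quantifiers in its definition.\<close>

locale automorphism =
  fixes \<V> :: "'a::field point set" and \<sigma> :: "'a point \<Rightarrow> 'a point"
  assumes bij: "bij \<sigma>" and iso: "variety_iso \<V> \<V> \<sigma>"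
begin

definition pull_fun :: "('a point \<Rightarrow> 'b) \<Rightarrow> 'a point \<Rightarrow> 'b" where
  "pull_fun f = (\<lambda>x. f (\<sigma> x))"

text \<open>The literal transport of a divisor. Unlike \<open>div_pullback\<close> it does not close the local
  equations under generic equality, and therefore commutes on the nose with all constructions.\<close>

definition pull :: "'a divisor \<Rightarrow> 'a divisor" where
  "pull D = (\<lambda>x. pull_fun ` D (\<sigma> x))"

lemma inj: "inj \<sigma>" and surj: "surj \<sigma>"
  using bij by (simp_all add: bij_def)

lemma pull_fun_apply [simp]: "pull_fun f x = f (\<sigma> x)"
  by (simp add: pull_fun_def)

lemma pull_fun_inv: "pull_fun (\<lambda>x. f (inv_into UNIV \<sigma> x)) = f"
  by (simp add: pull_fun_def inv_f_f[OF inj])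

lemma pull_fun_inject [simp]: "pull_fun f = pull_fun g \<longleftrightarrow> f = g"
  unfolding pull_fun_def using surj by (metis ext surjD)

text \<open>The reindexing rules: each of the quantifiers ranges over the image of a surjection.\<close>

lemma ex_pull_fun: "(\<exists>f. P f) \<longleftrightarrow> (\<exists>f. P (pull_fun f))"
  by (metis pull_fun_inv)

lemma all_pull_fun: "(\<forall>f. P f) \<longleftrightarrow> (\<forall>f. P (pull_fun f))"
  by (metis pull_fun_inv)

lemma ex_pull_funs: "(\<exists>b. P b) \<longleftrightarrow> (\<exists>b. P (\<lambda>i. pull_fun (b i)))"
proof
  assume "\<exists>b. P b"
  then obtain b where "P b" ..
  then have "P (\<lambda>i. pull_fun (\<lambda>x. b i (inv_into UNIV \<sigma> x)))" by (simp only: pull_fun_inv)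
  then show "\<exists>b. P (\<lambda>i. pull_fun (b i))" by (rule exI[where x = "\<lambda>i x. b i (inv_into UNIV \<sigma> x)"])
qed blast

lemma ex_vimage: "(\<exists>U. P U) \<longleftrightarrow> (\<exists>U. P (\<sigma> -` U))"
  by (metis bij bij_vimage_eq_inv_image inj_imp_surj_inv inj inj_vimage_image_eq)

lemma vimage_eq_empty: "\<sigma> -` U = {} \<longleftrightarrow> U = {}"
  using surj by (metis surj_image_vimage_eq image_empty vimage_empty)

lemma ball_vimage: "(\<forall>x\<in>\<sigma> -` U. P (\<sigma> x)) \<longleftrightarrow> (\<forall>x\<in>U. P x)"
  using surj by (metis surjD vimageE vimageI2)

lemma mem_iff [simp]: "\<sigma> x \<in> \<V> \<longleftrightarrow> x \<in> \<V>"
proof -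
  have "\<sigma> ` \<V> = \<V>" using iso by (simp add: variety_iso_def bij_betw_def)
  then show ?thesis using inj by (metis inj_image_mem_iff)
qed

lemma vimage_self: "\<sigma> -` \<V> = \<V>"
  by auto

lemma ball_self: "(\<forall>x\<in>\<V>. P (\<sigma> x)) \<longleftrightarrow> (\<forall>x\<in>\<V>. P x)"
  using ball_vimage[of \<V> P] by (simp add: vimage_self)

lemma zopen_vimage [simp]: "zopen \<V> (\<sigma> -` U) \<longleftrightarrow> zopen \<V> U"
proof (cases "U \<subseteq> \<V>")
  case True
  then have "\<V> \<inter> \<sigma> -` U = \<sigma> -` U" by auto
  then show ?thesis using iso True unfolding variety_iso_def by metis
next
  case False
  then obtain x where "x \<in> U" "x \<notin> \<V>" by blast
  then have "\<sigma> (inv_into UNIV \<sigma> x) \<in> U" "inv_into UNIV \<sigma> x \<notin> \<V>"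
    using surj_f_inv_f[OF surj] mem_iff[of "inv_into UNIV \<sigma> x"] by auto
  then have "\<not> \<sigma> -` U \<subseteq> \<V>" by auto
  then show ?thesis using False zopen_subset by blast
qed

lemma regular_on_vimage [simp]: "regular_on \<V> (\<sigma> -` U) (pull_fun f) \<longleftrightarrow> regular_on \<V> U f"
proof (cases "zopen \<V> U")
  case True
  then have "\<V> \<inter> \<sigma> -` U = \<sigma> -` U" using zopen_subset by fastforce
  moreover have "regular_on \<V> U f \<longleftrightarrow> regular_on \<V> (\<V> \<inter> \<sigma> -` U) (f \<circ> \<sigma>)"
    using iso True unfolding variety_iso_def by blast
  ultimately show ?thesis by (simp add: pull_fun_def comp_def)
next
  case False
  then show ?thesis by (metis regular_on_zopen zopen_vimage)
qed

lemma local_ring_pull [simp]: "pull_fun f \<in> local_ring \<V> x \<longleftrightarrow> f \<in> local_ring \<V> (\<sigma> x)"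
  unfolding local_ring_def mem_Collect_eq
  by (subst ex_vimage) simp

lemma generically_equal_pull [simp]:
  "generically_equal \<V> (pull_fun f) (pull_fun g) \<longleftrightarrow> generically_equal \<V> f g"
  unfolding generically_equal_def pull_fun_apply
  by (subst ex_vimage) (simp only: zopen_vimage vimage_eq_empty ball_vimage[where P = "\<lambda>x. f x = g x"])

lemma nonzero_rational_pull [simp]:
  "nonzero_rational \<V> (pull_fun f) \<longleftrightarrow> nonzero_rational \<V> f"
proof -
  have "(\<forall>x\<in>\<sigma> -` U. pull_fun f x \<noteq> 0) \<longleftrightarrow> (\<forall>x\<in>U. f x \<noteq> 0)" for U
    using ball_vimage[where P = "\<lambda>x. f x \<noteq> 0"] by simp
  then show ?thesis
    unfolding nonzero_rational_def
    by (subst ex_vimage) (simp only: regular_on_vimage vimage_eq_empty)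
qed

lemma pull_fun_mult: "(\<lambda>z. pull_fun f z * pull_fun g z) = pull_fun (\<lambda>z. f z * g z)"
  by (simp add: pull_fun_def)

lemma principal_at_pull [simp]:
  "pull_fun k \<in> principal_at \<V> (pull_fun f) x \<longleftrightarrow> k \<in> principal_at \<V> f (\<sigma> x)"
  unfolding principal_at_def mem_Collect_eq Bex_def
  by (subst ex_pull_fun) (simp add: pull_fun_mult del: pull_fun_apply, simp)

lemma mem_pull [simp]: "pull_fun k \<in> pull D x \<longleftrightarrow> k \<in> D (\<sigma> x)"
  by (auto simp: pull_def)

lemma bex_pull: "(\<exists>f\<in>pull D x. P f) \<longleftrightarrow> (\<exists>f\<in>D (\<sigma> x). P (pull_fun f))"
  by (simp add: pull_def)

lemma bex_local_ring: "(\<exists>f\<in>local_ring \<V> x. P f) \<longleftrightarrow> (\<exists>f\<in>local_ring \<V> (\<sigma> x). P (pull_fun f))"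
  unfolding Bex_def by (subst ex_pull_fun) simp

lemma set_eq_pull: "A = B \<longleftrightarrow> (\<forall>k. pull_fun k \<in> A \<longleftrightarrow> pull_fun k \<in> B)"
  unfolding set_eq_iff by (rule all_pull_fun)

lemma pull_eqI: "(\<And>x k. pull_fun k \<in> D x \<longleftrightarrow> k \<in> E (\<sigma> x)) \<Longrightarrow> D = pull E"
  by (rule ext) (simp add: set_eq_pull)

lemma pull_eq_iff: "pull D x = principal_at \<V> (pull_fun f) x \<longleftrightarrow> D (\<sigma> x) = principal_at \<V> f (\<sigma> x)"
proof -
  have "pull D x = principal_at \<V> (pull_fun f) x \<longleftrightarrow> (\<forall>k. k \<in> D (\<sigma> x) \<longleftrightarrow> k \<in> principal_at \<V> f (\<sigma> x))"
    by (simp add: set_eq_pull)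
  then show ?thesis by (simp add: set_eq_iff)
qed

lemma ex_pull: "(\<exists>D. P D) \<longleftrightarrow> (\<exists>D. P (pull D))"
proof
  assume "\<exists>D. P D"
  then obtain D where "P D" ..
  moreover have "D = pull (\<lambda>x. {f. pull_fun f \<in> D (inv_into UNIV \<sigma> x)})"
    by (rule pull_eqI) (simp add: inv_f_f[OF inj])
  ultimately show "\<exists>D. P (pull D)" by metis
qed blast

lemma pull_surj: obtains E where "D = pull E"
  using ex_pull[of "\<lambda>E. D = E"] by blast

lemma div_add_pull: "div_add \<V> (pull D) (pull E) = pull (div_add \<V> D E)"
  by (rule pull_eqI) (simp only: div_add_def UN_iff bex_pull pull_fun_mult principal_at_pull)

lemma div_scale_pull: "div_scale \<V> m (pull D) = pull (div_scale \<V> m D)"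
proof (rule pull_eqI)
  fix x k
  have "(\<lambda>z. pull_fun f z powi m) = pull_fun (\<lambda>z. f z powi m)" for f :: "'a pfun"
    by (simp add: pull_fun_def)
  then show "pull_fun k \<in> div_scale \<V> m (pull D) x \<longleftrightarrow> k \<in> div_scale \<V> m D (\<sigma> x)"
    by (simp only: div_scale_def UN_iff bex_pull principal_at_pull)
qed

lemma principal_pull: "principal \<V> (pull D) \<longleftrightarrow> principal \<V> D"
  unfolding principal_def
  by (subst ex_pull_fun)
    (simp only: nonzero_rational_pull pull_eq_iff ball_self[where P = "\<lambda>x. D x = principal_at \<V> _ x"])

lemma cartier_pull: "cartier \<V> (pull D) \<longleftrightarrow> cartier \<V> D"
proof -
  define P where "P x U f \<longleftrightarrow> zopen \<V> U \<and> x \<in> U \<and> nonzero_rational \<V> f \<and>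
    (\<forall>y\<in>U. D y = principal_at \<V> f y)" for x U f
  have "zopen \<V> (\<sigma> -` U) \<and> x \<in> \<sigma> -` U \<and> nonzero_rational \<V> (pull_fun f) \<and>
      (\<forall>y\<in>\<sigma> -` U. pull D y = principal_at \<V> (pull_fun f) y) \<longleftrightarrow> P (\<sigma> x) U f" for x U f
    unfolding P_def pull_eq_iff
    by (simp only: zopen_vimage nonzero_rational_pull vimage_eq
        ball_vimage[where P = "\<lambda>x. D x = principal_at \<V> f x"])
  then have "cartier \<V> (pull D) \<longleftrightarrow> (\<forall>x\<in>\<V>. \<exists>U f. P (\<sigma> x) U f)"
    unfolding cartier_def by (subst ex_vimage, subst ex_pull_fun) simp
  also have "\<dots> \<longleftrightarrow> (\<forall>x\<in>\<V>. \<exists>U f. P x U f)" by (rule ball_self)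
  finally show ?thesis by (simp add: cartier_def P_def)
qed

lemma effective_pull: "effective \<V> (pull D) \<longleftrightarrow> effective \<V> D"
proof -
  have "pull D y \<inter> local_ring \<V> y \<noteq> {} \<longleftrightarrow> D (\<sigma> y) \<inter> local_ring \<V> (\<sigma> y) \<noteq> {}" for y
  proof -
    have "(\<exists>f. f \<in> pull D y \<inter> local_ring \<V> y) \<longleftrightarrow> (\<exists>f. f \<in> D (\<sigma> y) \<inter> local_ring \<V> (\<sigma> y))"
      by (subst ex_pull_fun) simp
    then show ?thesis by blast
  qed
  then show ?thesis
    using ball_self[of "\<lambda>y. D y \<inter> local_ring \<V> y \<noteq> {}"] by (simp add: effective_def cartier_pull)
qed

lemma lin_equiv_pull: "lin_equiv \<V> (pull D) (pull E) \<longleftrightarrow> lin_equiv \<V> D E"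
  by (simp add: lin_equiv_def div_add_pull div_scale_pull principal_pull)

lemma div_support_pull: "div_support \<V> (pull D) = \<sigma> -` div_support \<V> D"
proof -
  have "(\<lambda>_. 1) = pull_fun (\<lambda>_. 1::'a)" by (simp add: pull_fun_def)
  then have "(\<lambda>_. 1) \<in> pull D y \<longleftrightarrow> (\<lambda>_. 1) \<in> D (\<sigma> y)" for y
    by (metis mem_pull)
  then show ?thesis by (auto simp: div_support_def)
qed

lemma meet_properly_pull: "meet_properly \<V> (pull D) (pull E) \<longleftrightarrow> meet_properly \<V> D E"
  unfolding meet_properly_def div_support_pull
  by (metis bij finite_vimage_iff vimage_Int)

lemma local_equations_ideal_pull:
  "pull_fun k \<in> local_equations_ideal \<V> (pull D) (pull E) y \<longleftrightarrow>
    k \<in> local_equations_ideal \<V> D E (\<sigma> y)"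
proof -
  have *: "(\<exists>f\<in>pull D y \<inter> local_ring \<V> y. P f) \<longleftrightarrow>
      (\<exists>f\<in>D (\<sigma> y) \<inter> local_ring \<V> (\<sigma> y). P (pull_fun f))" for P D
    unfolding Bex_def by (subst ex_pull_fun) simp
  have "(\<lambda>z. pull_fun a z * pull_fun f z + pull_fun b z * pull_fun g z) =
      pull_fun (\<lambda>z. a z * f z + b z * g z)" for a f b g :: "'a pfun"
    by (simp add: pull_fun_def)
  then show ?thesis
    unfolding local_equations_ideal_def mem_Collect_eq * bex_local_ring[where x = y]
    by (simp only: local_ring_pull generically_equal_pull)
qed

text \<open>A basis of one quotient is carried to a basis of the other, with the same coordinates.\<close>

lemma has_quotient_dim_pull:
  fixes V W V' W' :: "'a pfun set"
  assumes "\<And>k. pull_fun k \<in> V' \<longleftrightarrow> k \<in> V" "\<And>k. pull_fun k \<in> W' \<longleftrightarrow> k \<in> W"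
  shows "has_quotient_dim V' W' n \<longleftrightarrow> has_quotient_dim V W n"
proof -
  have *: "(\<forall>f\<in>V'. P f) \<longleftrightarrow> (\<forall>f\<in>V. P (pull_fun f))" for P
    unfolding Ball_def by (subst all_pull_fun) (simp add: assms)
  have **: "(\<lambda>x. pull_fun f x - (\<Sum>i<n. c i * pull_fun (b i) x)) =
      pull_fun (\<lambda>x. f x - (\<Sum>i<n. c i * b i x))" for f and b :: "nat \<Rightarrow> 'a pfun" and c
    by (simp add: pull_fun_def)
  show ?thesis
    unfolding has_quotient_dim_def
    by (subst ex_pull_funs) (simp only: * ** assms)
qed

lemma local_intersection_pull:
  "local_intersection \<V> (pull D) (pull E) y = local_intersection \<V> D E (\<sigma> y)"
proof -
  have "has_quotient_dim (local_ring \<V> y) (local_equations_ideal \<V> (pull D) (pull E) y) =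
      has_quotient_dim (local_ring \<V> (\<sigma> y)) (local_equations_ideal \<V> D E (\<sigma> y))"
    by (rule ext) (rule has_quotient_dim_pull[OF local_ring_pull local_equations_ideal_pull])
  then show ?thesis by (simp only: local_intersection_def)
qed

lemma proper_intersection_pull:
  "proper_intersection \<V> (pull D) (pull E) = proper_intersection \<V> D E"
proof -
  let ?S = "div_support \<V> D \<inter> div_support \<V> E"
  have "bij_betw \<sigma> (\<sigma> -` ?S) ?S"
    by (simp add: bij_betw_def inj_on_subset[OF inj] surj del: vimage_Int)
  then show ?thesis
    unfolding proper_intersection_def div_support_pull local_intersection_pull vimage_Int[symmetric]
    by (rule sum.reindex_bij_betw)
qed

text \<open>The numbers that qualify as intersection number are the same on both sides, because the
  representing effective divisors correspond under \<open>pull\<close>.\<close>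

lemma intersection_number_pull:
  "intersection_number \<V> (pull D) (pull E) = intersection_number \<V> D E"
proof -
  have *: "(\<exists>D1 D2 E1 E2. P D1 D2 E1 E2) \<longleftrightarrow> (\<exists>D1 D2 E1 E2. P (pull D1) (pull D2) (pull E1) (pull E2))"
    (is "?L \<longleftrightarrow> ?R") for P
  proof
    assume ?L
    then obtain D1 D2 E1 E2 where P: "P D1 D2 E1 E2" by blast
    obtain D1' where D1: "D1 = pull D1'" by (rule pull_surj)
    obtain D2' where D2: "D2 = pull D2'" by (rule pull_surj)
    obtain E1' where E1: "E1 = pull E1'" by (rule pull_surj)
    obtain E2' where E2: "E2 = pull E2'" by (rule pull_surj)
    show ?R using P unfolding D1 D2 E1 E2 by (intro exI)
  qed blast
  show ?thesis
    unfolding intersection_number_def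
    by (rule arg_cong[where f = The], rule ext, rule trans[OF *])
      (simp only: effective_pull div_scale_pull div_add_pull lin_equiv_pull meet_properly_pull
        proper_intersection_pull)
qed

lemma sections_map_pull:
  "sections_map \<V> (pull D) n (\<lambda>i. pull_fun (s i)) (pull_fun \<phi>) \<longleftrightarrow> sections_map \<V> D n s \<phi>"
proof -
  define P where "P x g r \<longleftrightarrow>
     (\<forall>i\<le>n. r i \<in> local_ring \<V> x \<and> generically_equal \<V> (r i) (\<lambda>z. s i z * g z)) \<and>
     (\<exists>i\<le>n. r i x \<noteq> 0) \<and> \<phi> x = proj_point (\<lambda>i. if i \<le> n then r i x else 0)" for x g r
  have "sections_map \<V> (pull D) n (\<lambda>i. pull_fun (s i)) (pull_fun \<phi>) \<longleftrightarrow>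
      (\<forall>x\<in>\<V>. \<exists>g\<in>D (\<sigma> x). \<exists>r. P (\<sigma> x) g r)"
    unfolding sections_map_def P_def bex_pull
    by (subst ex_pull_funs)
      (simp only: local_ring_pull pull_fun_mult generically_equal_pull, simp cong: if_cong)
  also have "\<dots> \<longleftrightarrow> (\<forall>x\<in>\<V>. \<exists>g\<in>D x. \<exists>r. P x g r)" by (rule ball_self)
  finally show ?thesis by (simp add: sections_map_def P_def)
qed

lemma pull_fun_image: "pull_fun \<phi> ` \<V> = \<phi> ` \<V>"
proof -
  have "\<sigma> ` \<V> = \<V>" using iso by (simp add: variety_iso_def bij_betw_def)
  moreover have "pull_fun \<phi> ` \<V> = \<phi> ` \<sigma> ` \<V>" by (simp add: image_image)
  ultimately show ?thesis by simp
qed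

lemma variety_iso_pull: "variety_iso \<V> Y (pull_fun \<phi>) \<longleftrightarrow> variety_iso \<V> Y \<phi>"
proof -
  have "bij_betw \<sigma> \<V> \<V>" using iso by (simp add: variety_iso_def)
  then have 1: "bij_betw (pull_fun \<phi>) \<V> Y \<longleftrightarrow> bij_betw \<phi> \<V> Y"
    using bij_betw_comp_iff[of \<sigma> \<V> \<V> \<phi> Y] by (simp add: pull_fun_def comp_def)
  have 2: "\<V> \<inter> pull_fun \<phi> -` W = \<sigma> -` (\<V> \<inter> \<phi> -` W)" for W
    by auto
  have 3: "f \<circ> pull_fun \<phi> = pull_fun (f \<circ> \<phi>)" for f :: "'a pfun"
    by (simp add: pull_fun_def comp_def)
  show ?thesis
    unfolding variety_iso_def 1 2 3 by (simp only: zopen_vimage regular_on_vimage)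
qed

text \<open>An embedding by sections of \<open>D\<close>, composed with \<open>\<sigma>\<close>, is an embedding by the transported
  sections, with the same image.\<close>

lemma very_ample_pull: "very_ample \<V> (pull D) \<longleftrightarrow> very_ample \<V> D"
proof -
  have "(\<exists>s \<phi>. sections_map \<V> (pull D) n s \<phi> \<and> projective_set UNIV n (\<phi> ` \<V>) \<and>
      variety_iso \<V> (\<phi> ` \<V>) \<phi>) \<longleftrightarrow>
    (\<exists>s \<phi>. sections_map \<V> D n s \<phi> \<and> projective_set UNIV n (\<phi> ` \<V>) \<and>
      variety_iso \<V> (\<phi> ` \<V>) \<phi>)" for n
    by (subst ex_pull_funs, subst ex_pull_fun)
      (simp only: sections_map_pull pull_fun_image variety_iso_pull)
  then show ?thesis by (simp add: very_ample_def cartier_pull)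
qed

lemma ample_pull: "ample \<V> (pull D) \<longleftrightarrow> ample \<V> D"
  by (simp add: ample_def cartier_pull div_scale_pull very_ample_pull)

end

section \<open>The action on the Neron-Severi space\<close>

lemma axis_integral: "axis i 1 \<in> (integral_vectors :: (real ^ 'r) set)"
  by (simp add: integral_vectors_def axis_def)

lemma integral_vectors_add: "v \<in> integral_vectors \<Longrightarrow> w \<in> integral_vectors \<Longrightarrow> v + w \<in> integral_vectors"
  by (simp add: integral_vectors_def)

lemma integral_vectors_minus: "v \<in> integral_vectors \<Longrightarrow> - v \<in> integral_vectors"
  by (simp add: integral_vectors_def)

lemma integral_vectors_scale:
  "v \<in> integral_vectors \<Longrightarrow> c \<in> \<int> \<Longrightarrow> c *\<^sub>R v \<in> integral_vectors"
  by (simp add: integral_vectors_def)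

lemma linear_eq_on_integral_vectors:
  fixes f g :: "real ^ 'r \<Rightarrow> 'b::real_vector"
  assumes "linear f" "linear g" "\<And>v. v \<in> integral_vectors \<Longrightarrow> f v = g v"
  shows "f = g"
proof (rule linear_eq_stdbasis[OF assms(1,2)])
  fix b :: "real ^ 'r" assume "b \<in> Basis"
  then obtain i where "b = axis i 1" by (auto simp: Basis_vec_def)
  then show "f b = g b" using assms(3) axis_integral by blast
qed

text \<open>A homomorphism from the integral vectors to a real vector space is determined by its values
  on the standard basis, which also define the extension.\<close>

lemma additive_extends_linearly:
  fixes \<phi> :: "real ^ 'r \<Rightarrow> 'b::real_vector"
  assumes add: "\<And>v w. v \<in> integral_vectors \<Longrightarrow> w \<in> integral_vectors \<Longrightarrow> \<phi> (v + w) = \<phi> v + \<phi> w"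
  obtains T where "linear T" "\<And>v. v \<in> integral_vectors \<Longrightarrow> T v = \<phi> v"
proof
  let ?T = "\<lambda>x. \<Sum>i\<in>UNIV. x $ i *\<^sub>R \<phi> (axis i 1)"
  show "linear ?T"
    by (rule linearI) (simp_all add: scaleR_left_distrib sum.distrib scaleR_sum_right)
  have zero: "\<phi> 0 = 0"
    using add[of 0 0] by (simp add: integral_vectors_def)
  have minus: "\<phi> (- v) = - \<phi> v" if "v \<in> integral_vectors" for v
    using add[OF that integral_vectors_minus[OF that]] zero by (simp add: add_eq_0_iff)
  have nat: "\<phi> (real n *\<^sub>R v) = real n *\<^sub>R \<phi> v" if v: "v \<in> integral_vectors" for n v
  proof (induction n)
    case (Suc n)
    have "\<phi> (real (Suc n) *\<^sub>R v) = \<phi> (real n *\<^sub>R v + v)"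
      by (simp add: algebra_simps)
    also have "\<dots> = real n *\<^sub>R \<phi> v + \<phi> v"
      using add[of "real n *\<^sub>R v" v] v Suc by (simp add: integral_vectors_scale)
    finally show ?case by (simp add: algebra_simps)
  qed (simp add: zero)
  have int: "\<phi> (c *\<^sub>R v) = c *\<^sub>R \<phi> v" if "c \<in> \<int>" and v: "v \<in> integral_vectors" for c v
  proof -
    obtain z where c: "c = of_int z" using \<open>c \<in> \<int>\<close> by (rule Ints_cases)
    show ?thesis
    proof (cases z)
      case (nonneg n)
      then show ?thesis using nat[OF v, of n] by (simp add: c)
    next
      case (neg n)
      then have z: "c = - real (Suc n)" by (simp add: c)
      have "\<phi> (- (real (Suc n) *\<^sub>R v)) = - \<phi> (real (Suc n) *\<^sub>R v)"
        by (rule minus[OF integral_vectors_scale[OF v]]) simp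
      then show ?thesis
        unfolding z nat[OF v, of "Suc n"] scaleR_minus_left .
    qed
  qed
  show "?T v = \<phi> v" if v: "v \<in> integral_vectors" for v
  proof -
    have sum: "(\<Sum>i\<in>I. v $ i *\<^sub>R axis i 1) \<in> integral_vectors \<and>
        \<phi> (\<Sum>i\<in>I. v $ i *\<^sub>R axis i 1) = (\<Sum>i\<in>I. v $ i *\<^sub>R \<phi> (axis i 1))" for I :: "'r set"
    proof (induction I rule: infinite_finite_induct)
      case (insert i I)
      have i: "v $ i \<in> \<int>" using v by (simp add: integral_vectors_def)
      have "v $ i *\<^sub>R axis i 1 \<in> integral_vectors"
        using integral_vectors_scale[OF axis_integral i] .
      then have "\<phi> (v $ i *\<^sub>R axis i 1 + (\<Sum>i\<in>I. v $ i *\<^sub>R axis i 1)) =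
          \<phi> (v $ i *\<^sub>R axis i 1) + \<phi> (\<Sum>i\<in>I. v $ i *\<^sub>R axis i 1)"
        using insert.IH by (intro add) blast+
      then show ?case
        using insert.IH integral_vectors_add[OF \<open>v $ i *\<^sub>R axis i 1 \<in> integral_vectors\<close>]
        by (simp only: sum.insert[OF insert.hyps] int[OF i axis_integral])
    qed (simp_all add: zero integral_vectors_def)
    have "(\<Sum>i\<in>UNIV. v $ i *\<^sub>R axis i 1) = v"
      using basis_expansion[of v] by (simp add: scalar_mult_eq_scaleR)
    then show ?thesis using sum[of UNIV] by simp
  qed
qed

text \<open>The automorphism together with a marking of the Picard group; here the algebra of Cartier
  divisors on an irreducible set meets the exact transport.\<close>

locale marked_automorphism = irreducible_projective \<V> N + automorphism \<V> \<sigma>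
  for \<V> :: "'a::field point set" and N \<sigma> +
  fixes cls :: "'a divisor \<Rightarrow> real ^ 'r"
  assumes marking: "NS_marking \<V> cls"
begin

lemma cls_add: "cartier \<V> D \<Longrightarrow> cartier \<V> E \<Longrightarrow> cls (div_add \<V> D E) = cls D + cls E"
  and cls_zero: "cartier \<V> D \<Longrightarrow> cls D = 0 \<longleftrightarrow> principal \<V> D"
  and cls_image: "cls ` {D. cartier \<V> D} = integral_vectors"
  using marking by (simp_all add: NS_marking_def)

lemma cls_integral: "cartier \<V> D \<Longrightarrow> cls D \<in> integral_vectors"
  using cls_image by blast

lemma integral_cls:
  assumes "v \<in> integral_vectors"
  obtains D where "cartier \<V> D" "cls D = v"
proof -
  have "v \<in> cls ` {D. cartier \<V> D}" using assms by (simp add: cls_image)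
  then show ?thesis by (elim imageE) (rule that, simp_all)
qed

lemma opposite_divisor:
  assumes "cartier \<V> D"
  obtains F where "cartier \<V> F" "cls F = - cls D"
  by (rule integral_cls[OF integral_vectors_minus[OF cls_integral[OF assms]]]) (rule that)

text \<open>Equality of classes becomes principality of a divisor, a property that can be transported.
  The marking supplies such an \<open>F\<close>.\<close>

lemma cls_eq_iff:
  assumes "cartier \<V> D" "cartier \<V> F" "cls F = - v"
  shows "cls D = v \<longleftrightarrow> principal \<V> (div_add \<V> D F)"
  using cls_add[OF assms(1,2)] cls_zero[OF cartier_div_add[OF assms(1,2)]] assms(3) by auto

text \<open>The marking is defined on functions of all points but sees a divisor only on \<open>\<V>\<close>. This is needed
  because pullback and exact transport agree only there.\<close>

lemma cls_cong:
  assumes D: "cartier \<V> D" and eq: "\<And>y. y \<in> \<V> \<Longrightarrow> D y = E y"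
  shows "cls D = cls E"
proof -
  have E: "cartier \<V> E" using D cartier_cong[of \<V> D E] eq by blast
  obtain F where F: "cartier \<V> F" "cls F = - cls D" using opposite_divisor[OF D] .
  have "\<And>y. y \<in> \<V> \<Longrightarrow> div_add \<V> D F y = div_add \<V> E F y"
    by (simp add: div_add_def eq)
  then have "principal \<V> (div_add \<V> D F) \<longleftrightarrow> principal \<V> (div_add \<V> E F)"
    by (simp add: principal_def)
  then show ?thesis
    using cls_eq_iff[OF D F] cls_eq_iff[OF E F] by simp
qed

lemma cls_pull_well_defined:
  assumes D: "cartier \<V> D" and E: "cartier \<V> E" and eq: "cls D = cls E"
  shows "cls (pull D) = cls (pull E)"
proof -
  obtain F where F: "cartier \<V> F" "cls F = - cls D" using opposite_divisor[OF D] .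
  have "cls (pull G) = - cls (pull F)" if G: "cartier \<V> G" "cls G = cls D" for G
  proof -
    have "principal \<V> (div_add \<V> G F)" using cls_eq_iff[OF G(1) F] G(2) by simp
    then have "principal \<V> (div_add \<V> (pull G) (pull F))"
      by (simp add: div_add_pull principal_pull)
    then show ?thesis
      using cls_eq_iff[of "pull G" "pull F" "- cls (pull F)"] G(1) F(1) by (simp add: cartier_pull)
  qed
  then show ?thesis using D E eq by metis
qed

text \<open>Both contain the pulled back local equations; the pullback adds what is generically equal to
  them, which by saturation is again a pulled back local equation.\<close>

lemma pull_eq_div_pullback:
  assumes D: "cartier \<V> D" and \<gamma>: "\<And>x. x \<in> \<V> \<Longrightarrow> \<gamma> x = \<sigma> x" and y: "y \<in> \<V>"
  shows "div_pullback \<V> \<gamma> D y = pull D y"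
proof -
  have eq: "generically_equal \<V> (f \<circ> \<gamma>) (pull_fun f)" for f :: "'a pfun"
    by (rule generically_equalI) (simp add: \<gamma>)
  have "pull_fun k \<in> div_pullback \<V> \<gamma> D y \<longleftrightarrow> k \<in> D (\<sigma> y)" for k
  proof
    assume "pull_fun k \<in> div_pullback \<V> \<gamma> D y"
    then obtain f where f: "f \<in> D (\<sigma> y)" "generically_equal \<V> (pull_fun k) (f \<circ> \<gamma>)"
      unfolding div_pullback_def mem_Collect_eq \<gamma>[OF y] by (elim bexE) (rule that)
    then have "generically_equal \<V> k f"
      using generically_equal_trans[OF f(2) eq] by simp
    then show "k \<in> D (\<sigma> y)" using cartier_saturated[OF D _ f(1)] y by simp
  next
    assume "k \<in> D (\<sigma> y)"
    then show "pull_fun k \<in> div_pullback \<V> \<gamma> D y"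
      unfolding div_pullback_def mem_Collect_eq \<gamma>[OF y]
      using generically_equal_sym[OF eq] by (rule bexI[rotated])
  qed
  then show ?thesis by (simp add: set_eq_pull)
qed

text \<open>By transport, linearly equivalent divisors have linearly equivalent pullbacks, so pulling back
  is well defined on classes. It is additive on the lattice and extends linearly, and the extension
  is unique because the lattice spans; hence the definite description of \<open>NS_pullback\<close> denotes it.\<close>

lemma NS_action:
  assumes \<gamma>: "\<And>x. x \<in> \<V> \<Longrightarrow> \<gamma> x = \<sigma> x"
  shows "linear (NS_pullback \<V> cls \<gamma>)"
    and "cartier \<V> D \<Longrightarrow> NS_pullback \<V> cls \<gamma> (cls D) = cls (pull D)"
proof -
  define \<phi> where "\<phi> v = cls (pull (SOME D. cartier \<V> D \<and> cls D = v))" for v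
  have \<phi>: "\<phi> (cls D) = cls (pull D)" if "cartier \<V> D" for D
  proof -
    have "cartier \<V> (SOME E. cartier \<V> E \<and> cls E = cls D) \<and>
        cls (SOME E. cartier \<V> E \<and> cls E = cls D) = cls D"
      by (rule someI[where x = D]) (simp add: that)
    then show ?thesis unfolding \<phi>_def using that cls_pull_well_defined by blast
  qed
  have "\<phi> (v + w) = \<phi> v + \<phi> w" if vw: "v \<in> integral_vectors" "w \<in> integral_vectors" for v w
  proof -
    obtain D where D: "cartier \<V> D" "cls D = v" using integral_cls[OF vw(1)] .
    obtain E where E: "cartier \<V> E" "cls E = w" using integral_cls[OF vw(2)] .
    have "\<phi> (cls (div_add \<V> D E)) = cls (pull D) + cls (pull E)"
      using \<phi>[OF cartier_div_add[OF D(1) E(1)]] cls_add[of "pull D" "pull E"] D(1) E(1)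
      by (simp add: cartier_pull div_add_pull)
    then show ?thesis using \<phi> D E cls_add by metis
  qed
  then obtain T where T: "linear T" "\<And>v. v \<in> integral_vectors \<Longrightarrow> T v = \<phi> v"
    using additive_extends_linearly by blast
  have pb: "cls (div_pullback \<V> \<gamma> D) = cls (pull D)" if "cartier \<V> D" for D
    using cls_cong[of "pull D" "div_pullback \<V> \<gamma> D"] pull_eq_div_pullback[OF that \<gamma>] that
    by (simp add: cartier_pull)
  have T_cls: "T (cls D) = cls (pull D)" if "cartier \<V> D" for D
    using that T(2) \<phi> cls_integral by simp
  have "NS_pullback \<V> cls \<gamma> = T"
    unfolding NS_pullback_def
  proof (rule the_equality)
    show "linear T \<and> (\<forall>D. cartier \<V> D \<longrightarrow> T (cls D) = cls (div_pullback \<V> \<gamma> D))"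
      using T(1) T_cls pb by simp
    fix S assume S: "linear S \<and> (\<forall>D. cartier \<V> D \<longrightarrow> S (cls D) = cls (div_pullback \<V> \<gamma> D))"
    show "S = T"
    proof (rule linear_eq_on_integral_vectors)
      show "linear S" "linear T" using S T(1) by auto
      fix v :: "real ^ 'r" assume "v \<in> integral_vectors"
      then obtain D where "cartier \<V> D" "cls D = v" by (rule integral_cls)
      then show "S v = T v" using S T_cls pb by auto
    qed
  qed
  then show "linear (NS_pullback \<V> cls \<gamma>)"
    and "cartier \<V> D \<Longrightarrow> NS_pullback \<V> cls \<gamma> (cls D) = cls (pull D)"
    using T(1) T_cls by simp_all
qed

context
  fixes T :: "real ^ 'r \<Rightarrow> real ^ 'r"
  assumes lin: "linear T" and T_cls: "\<And>D. cartier \<V> D \<Longrightarrow> T (cls D) = cls (pull D)"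
begin

lemma NS_action_integral: "T ` integral_vectors = integral_vectors"
proof -
  have "T ` cls ` {D. cartier \<V> D} = cls ` {D. cartier \<V> D}"
  proof (intro subset_antisym subsetI)
    fix v assume "v \<in> T ` cls ` {D. cartier \<V> D}"
    then show "v \<in> cls ` {D. cartier \<V> D}" using T_cls cartier_pull by fastforce
  next
    fix v assume "v \<in> cls ` {D. cartier \<V> D}"
    then obtain D where D: "cartier \<V> D" "v = cls D" by blast
    obtain E where E: "D = pull E" by (rule pull_surj)
    then have "cartier \<V> E" using D(1) by (simp add: cartier_pull)
    then have "v = T (cls E)" using D(2) E T_cls by simp
    then show "v \<in> T ` cls ` {D. cartier \<V> D}" using \<open>cartier \<V> E\<close> by blast
  qed
  then show ?thesis by (simp add: cls_image)
qed

lemma NS_action_isometry: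
  assumes "intersection_form \<V> cls Q"
  shows "Q (T v) (T w) = Q v w"
proof -
  have Q: "bilinear Q" "\<And>D E. cartier \<V> D \<Longrightarrow> cartier \<V> E \<Longrightarrow>
      Q (cls D) (cls E) = of_int (intersection_number \<V> D E)"
    using assms by (auto simp: intersection_form_def)
  have int: "Q (T v) (T w) = Q v w" if vw: "v \<in> integral_vectors" "w \<in> integral_vectors" for v w
  proof -
    obtain D where D: "cartier \<V> D" "cls D = v" using integral_cls[OF vw(1)] .
    obtain E where E: "cartier \<V> E" "cls E = w" using integral_cls[OF vw(2)] .
    show ?thesis
      unfolding D(2)[symmetric] E(2)[symmetric]
      using Q(2) T_cls D(1) E(1) by (simp add: cartier_pull intersection_number_pull)
  qed
  have left: "linear (\<lambda>v. Q v w)" and right: "linear (\<lambda>w. Q v w)" for v w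
    using Q(1) by (simp_all add: bilinear_def)
  have "(\<lambda>w. Q (T v) (T w)) = (\<lambda>w. Q v w)" if "v \<in> integral_vectors" for v
    using linear_compose[OF lin right] right int that
    by (intro linear_eq_on_integral_vectors) (simp_all add: comp_def)
  then have "(\<lambda>v. Q (T v) (T w)) = (\<lambda>v. Q v w)" for w
    using linear_compose[OF lin left] left
    by (intro linear_eq_on_integral_vectors) (auto simp: comp_def dest: fun_cong)
  then show ?thesis by (auto dest: fun_cong)
qed

lemma NS_action_ample_cone: "T ` ample_cone \<V> cls = ample_cone \<V> cls"
proof -
  have image: "T (\<Sum>i<n. c i *\<^sub>R cls (D i)) = (\<Sum>i<n. c i *\<^sub>R cls (pull (D i)))"
    if "\<forall>i<n. c i > 0 \<and> ample \<V> (D i)" for n :: nat and c D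
    using that by (simp add: linear_sum[OF lin] linear_scale[OF lin] T_cls ample_def)
  show ?thesis
  proof (intro subset_antisym subsetI)
    fix v assume "v \<in> T ` ample_cone \<V> cls"
    then obtain n :: nat and c D where "n > 0" "\<forall>i<n. c i > 0 \<and> ample \<V> (D i)"
      "v = T (\<Sum>i<n. c i *\<^sub>R cls (D i))"
      by (auto simp: ample_cone_def)
    then show "v \<in> ample_cone \<V> cls"
      unfolding ample_cone_def mem_Collect_eq
      by (intro exI[of _ n] exI[of _ c] exI[of _ "\<lambda>i. pull (D i)"]) (simp add: image ample_pull)
  next
    fix v assume "v \<in> ample_cone \<V> cls"
    then obtain n :: nat and c D where n: "n > 0" and D: "\<forall>i<n. c i > 0 \<and> ample \<V> (D i)"
      and v: "v = (\<Sum>i<n. c i *\<^sub>R cls (D i))"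
      unfolding ample_cone_def by blast
    have "\<forall>i. \<exists>E. D i = pull E" using pull_surj by metis
    then obtain E where E: "\<And>i. D i = pull (E i)" by metis
    then have E_ample: "\<forall>i<n. c i > 0 \<and> ample \<V> (E i)" using D by (simp add: ample_pull)
    then have "v = T (\<Sum>i<n. c i *\<^sub>R cls (E i))" using image v E by simp
    moreover have "(\<Sum>i<n. c i *\<^sub>R cls (E i)) \<in> ample_cone \<V> cls"
      unfolding ample_cone_def using n E_ample by blast
    ultimately show "v \<in> T ` ample_cone \<V> cls" by blast
  qed
qed

end

end

section \<open>The enlarged boundary over the irrational points\<close>

text \<open>Clearing denominators replaces rational rays by rays through the lattice, which a lattice
  isometry visibly preserves.\<close>

lemma rational_vector_denominator:
  fixes y :: "real ^ 'r"
  assumes "\<forall>i. y $ i \<in> \<rat>"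
  obtains n :: nat where "n > 0" "real n *\<^sub>R y \<in> integral_vectors"
proof -
  have "\<exists>b::nat. b > 0 \<and> real b * y $ i \<in> \<int>" for i
  proof -
    obtain a b :: int where "b > 0" "y $ i = of_int a / of_int b"
      using assms by (metis Rats_cases')
    then show ?thesis by (intro exI[of _ "nat b"]) simp
  qed
  then obtain b :: "'r \<Rightarrow> nat" where b: "\<And>i. b i > 0" "\<And>i. real (b i) * y $ i \<in> \<int>"
    by metis
  let ?n = "\<Prod>i\<in>UNIV. b i"
  have "real ?n * y $ i \<in> \<int>" for i
  proof -
    have "real ?n * y $ i = real (\<Prod>j\<in>UNIV - {i}. b j) * (real (b i) * y $ i)"
      by (subst prod.remove[of UNIV i]) simp_all
    then show ?thesis using Ints_mult[OF Ints_of_nat b(2)] by metis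
  qed
  then have "real ?n *\<^sub>R y \<in> integral_vectors" by (simp add: integral_vectors_def)
  moreover have "?n > 0" using b(1) by (simp add: prod_pos)
  ultimately show ?thesis using that by blast
qed

lemma irrational_boundary_integral:
  fixes A :: "(real ^ 'r) set"
  shows "irrational_boundary A = {x \<in> cone_boundary A. \<forall>c. c \<noteq> 0 \<longrightarrow> c *\<^sub>R x \<notin> integral_vectors}"
proof -
  have "(\<exists>c. c \<noteq> 0 \<and> (\<forall>i. (c *\<^sub>R x) $ i \<in> \<rat>)) \<longleftrightarrow> (\<exists>c. c \<noteq> 0 \<and> c *\<^sub>R x \<in> integral_vectors)"
    for x :: "real ^ 'r"
  proof
    assume "\<exists>c. c \<noteq> 0 \<and> (\<forall>i. (c *\<^sub>R x) $ i \<in> \<rat>)"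
    then obtain c where c: "c \<noteq> 0" "\<forall>i. (c *\<^sub>R x) $ i \<in> \<rat>" by blast
    obtain n :: nat where "n > 0" "real n *\<^sub>R (c *\<^sub>R x) \<in> integral_vectors"
      using c(2) by (rule rational_vector_denominator)
    then show "\<exists>c. c \<noteq> 0 \<and> c *\<^sub>R x \<in> integral_vectors"
      using c(1) by (intro exI[of _ "real n * c"]) simp
  next
    assume "\<exists>c. c \<noteq> 0 \<and> c *\<^sub>R x \<in> integral_vectors"
    then show "\<exists>c. c \<noteq> 0 \<and> (\<forall>i. (c *\<^sub>R x) $ i \<in> \<rat>)"
      using Ints_subset_Rats unfolding integral_vectors_def by blast
  qed
  then show ?thesis unfolding irrational_boundary_def by (simp only:) blast
qed

text \<open>Parabolic classes are integral, so the lift of an irrational class to every blow-up is given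
  by the graph itself.\<close>

lemma irrational_not_on_parabolic_ray:
  assumes x: "x \<in> irrational_boundary A" and E: "E \<in> parabolic A"
  shows "x \<notin> span {E}"
proof
  assume "x \<in> span {E}"
  then obtain k where k: "x = k *\<^sub>R E" by (auto simp: span_singleton)
  have "x \<noteq> 0" using x by (simp add: irrational_boundary_def cone_boundary_def)
  then have "inverse k *\<^sub>R x = E" "inverse k \<noteq> 0" using k by auto
  moreover have "E \<in> integral_vectors" using E by (simp add: parabolic_def)
  ultimately show False using x unfolding irrational_boundary_integral by auto
qed

lemma openin_planes_topology:
  "openin (planes_topology E) S \<longleftrightarrow> S \<subseteq> {span {E, x} | x. x \<notin> span {E}} \<and>
     open {x. x \<notin> span {E} \<and> span {E, x} \<in> S}"
  unfolding planes_topology_def by (simp add: topology_inverse'[OF istopology_planes])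

lemma open_off_ray: "open {x. x \<notin> span {E :: real ^ 'r}}"
  using closed_span[of "{E}"] by (simp add: closed_def Compl_eq)

lemma topspace_planes_topology: "topspace (planes_topology E) = {span {E, x} | x. x \<notin> span {E}}"
proof
  show "topspace (planes_topology E) \<subseteq> {span {E, x} | x. x \<notin> span {E}}"
    using openin_topspace[of "planes_topology E"] unfolding openin_planes_topology by blast
  have "{x. x \<notin> span {E} \<and> span {E, x} \<in> {span {E, x} | x. x \<notin> span {E}}} = {x. x \<notin> span {E}}"
    by blast
  then have "openin (planes_topology E) {span {E, x} | x. x \<notin> span {E}}"
    unfolding openin_planes_topology using open_off_ray[of E] by simp
  then show "{span {E, x} | x. x \<notin> span {E}} \<subseteq> topspace (planes_topology E)"
    by (rule openin_subset)
qed

text \<open>The functionals come from the independence of \<open>E\<close>, \<open>x\<close> and \<open>y\<close>. Comparing their absolute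
  values separates the two planes, which gives the Hausdorff property of the space of planes.\<close>

lemma separating_functionals:
  fixes E x y :: "real ^ 'r"
  assumes E: "E \<noteq> 0" and x: "x \<notin> span {E}" and y: "y \<notin> span {E}"
    and neq: "span {E, x} \<noteq> span {E, y}"
  obtains f g :: "real ^ 'r \<Rightarrow> real" where "linear f" "linear g"
    "f E = 0" "g E = 0" "f x = 1" "g x = 0" "f y = 0" "g y = 1"
proof -
  have y': "y \<notin> span {x, E}"
  proof
    assume yx: "y \<in> span {x, E}"
    then have xy: "x \<in> span {y, E}" using y by (rule in_span_insert)
    have "span {x, E} = span {y, E}"
      using xy yx by (simp add: span_eq span_base)
    then show False using neq by (simp add: insert_commute)
  qed
  have ind: "independent {y, x, E}"
    using E x y' by (intro independent_insertI) (simp_all add: insert_commute independent_empty)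
  have ne: "x \<noteq> E" "y \<noteq> E" "y \<noteq> x" using x y y' span_base by blast+
  obtain f :: "real ^ 'r \<Rightarrow> real" where f: "linear f" "\<forall>z\<in>{y, x, E}. f z = (if z = x then 1 else 0)"
    using linear_independent_extend[OF ind, of "\<lambda>z. if z = x then 1 else 0 :: real"] by blast
  obtain g :: "real ^ 'r \<Rightarrow> real" where g: "linear g" "\<forall>z\<in>{y, x, E}. g z = (if z = y then 1 else 0)"
    using linear_independent_extend[OF ind, of "\<lambda>z. if z = y then 1 else 0 :: real"] by blast
  show ?thesis using that[OF f(1) g(1)] f(2) g(2) ne by simp
qed

text \<open>Modulo \<open>E\<close> the two vectors differ by a nonzero factor, which cancels. So the comparison of
  absolute values is a condition on the plane and not on the spanning vector.\<close>

lemma functionals_on_plane: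
  fixes f g :: "real ^ 'r \<Rightarrow> real"
  assumes lin: "linear f" "linear g" and E: "f E = 0" "g E = 0"
    and z': "z' \<notin> span {E}" "span {E, z'} = span {E, z}"
  shows "\<bar>f z'\<bar> < \<bar>g z'\<bar> \<longleftrightarrow> \<bar>f z\<bar> < \<bar>g z\<bar>"
proof -
  have "z' \<in> span {E, z}" using z'(2) span_base[of z' "{E, z'}"] by simp
  then have "z' \<in> span (insert z {E})" by (simp add: insert_commute)
  then obtain c where "z' - c *\<^sub>R z \<in> span {E}" by (auto simp: span_breakdown_eq)
  then obtain k where "z' - c *\<^sub>R z = k *\<^sub>R E" by (auto simp: span_singleton)
  then have k: "z' = k *\<^sub>R E + c *\<^sub>R z" by (simp add: algebra_simps)
  have "c \<noteq> 0" using k z'(1) by (auto simp: span_singleton)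
  moreover have "f z' = c * f z" "g z' = c * g z"
    using lin E by (simp_all add: k linear_add linear_scale)
  ultimately show ?thesis by (simp add: abs_mult)
qed

definition irrational_lift :: "(real ^ 'r) set \<Rightarrow> real ^ 'r \<Rightarrow> 'r boundary_point" where
  "irrational_lift A x = (x, \<lambda>E\<in>parabolic A. span {E, x})"

lemma irrational_lift_in_enlarged_boundary:
  assumes x: "x \<in> irrational_boundary A"
  shows "irrational_lift A x \<in> enlarged_boundary A Q \<omega>0"
proof -
  have "to_stage (parabolic_upto A Q \<omega>0 R) (irrational_lift A x) \<in> topspace (blowup A (parabolic_upto A Q \<omega>0 R))"
    for R
  proof -
    let ?P = "parabolic_upto A Q \<omega>0 R"
    let ?T = "prod_topology (top_of_set (cone_boundary A)) (product_topology planes_topology ?P)"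
    let ?G = "{(x, \<lambda>E\<in>?P. span {E, x}) | x. x \<in> cone_boundary A \<and> (\<forall>E\<in>?P. x \<notin> span {E})}"
    have P: "?P \<subseteq> parabolic A" by (auto simp: parabolic_upto_def)
    then have off: "\<forall>E\<in>?P. x \<notin> span {E}" using irrational_not_on_parabolic_ray[OF x] by blast
    have cb: "x \<in> cone_boundary A" using x by (simp add: irrational_boundary_def)
    have stage: "to_stage ?P (irrational_lift A x) = (x, \<lambda>E\<in>?P. span {E, x})"
      using P by (simp add: to_stage_def irrational_lift_def restrict_restrict Int_absorb1)
    have G: "(x, \<lambda>E\<in>?P. span {E, x}) \<in> ?G" using off cb by blast
    have "(x, \<lambda>E\<in>?P. span {E, x}) \<in> topspace ?T"
      using off cb by (auto simp: topspace_planes_topology)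
    then have "(x, \<lambda>E\<in>?P. span {E, x}) \<in> ?T closure_of ?G"
      using G unfolding in_closure_of by blast
    then show ?thesis
      unfolding stage blowup_def Let_def topspace_subtopology using closure_of_subset_topspace by fastforce
  qed
  then show ?thesis by (simp add: enlarged_boundary_def irrational_lift_def)
qed

text \<open>Away from the ray of \<open>E\<close> the projection from \<open>E\<close> is continuous and spaces of planes are
  Hausdorff, so the closure of its graph acquires no further points there.\<close>

lemma enlarged_boundary_over_irrational:
  fixes A :: "(real ^ 'r) set"
  assumes a: "a \<in> enlarged_boundary A Q \<omega>0" and irr: "fst a \<in> irrational_boundary A"
  shows "a = irrational_lift A (fst a)"
proof -
  define x L where "x = fst a" and "L = snd a"
  have ext: "L \<in> extensional (parabolic A)" using a by (simp add: enlarged_boundary_def L_def)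
  have "L E = span {E, x}" if E: "E \<in> parabolic A" for E
  proof (rule ccontr)
    assume neq: "L E \<noteq> span {E, x}"
    \<comment> \<open>The first stage in which the ray of \<open>E\<close> is blown up.\<close>
    define P where "P = parabolic_upto A Q \<omega>0 (Q \<omega>0 E)"
    have EP: "E \<in> P" using E by (simp add: P_def parabolic_upto_def)
    let ?T = "prod_topology (top_of_set (cone_boundary A)) (product_topology planes_topology P)"
    let ?G = "{(x, \<lambda>E\<in>P. span {E, x}) | x. x \<in> cone_boundary A \<and> (\<forall>E\<in>P. x \<notin> span {E})}"
    have "to_stage P a \<in> topspace (blowup A P)"
      using a unfolding enlarged_boundary_def P_def by blast
    then have cl: "(x, restrict L P) \<in> ?T closure_of ?G"
      unfolding blowup_def Let_def topspace_subtopology to_stage_def x_def L_def by blast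
    then have top: "(x, restrict L P) \<in> topspace ?T" by (rule subsetD[OF closure_of_subset_topspace])
    then have "L E \<in> topspace (planes_topology E)"
      using EP by (auto simp: PiE_iff)
    then obtain y where y: "y \<notin> span {E}" "L E = span {E, y}"
      unfolding topspace_planes_topology by blast
    have E0: "E \<noteq> 0" using E by (simp add: parabolic_def cone_boundary_def)
    have xE: "x \<notin> span {E}" using irrational_not_on_parabolic_ray[OF irr E] by (simp add: x_def)
    obtain f g :: "real ^ 'r \<Rightarrow> real" where fg: "linear f" "linear g" "f E = 0" "g E = 0"
        "f x = 1" "g x = 0" "f y = 0" "g y = 1"
      using separating_functionals[OF E0 xE y(1)] neq y(2) by metis
    have cont: "continuous_on UNIV f" "continuous_on UNIV g"
      using fg(1,2) by (simp_all add: linear_continuous_on linear_conv_bounded_linear)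
    \<comment> \<open>\<open>W\<close> is a neighbourhood of \<open>x\<close> and \<open>S\<close> one of \<open>L E\<close>. No plane through \<open>E\<close> and a point of \<open>W\<close>
      belongs to \<open>S\<close>, so together they define a neighbourhood that misses the graph.\<close>
    define W where "W = {z. \<bar>g z\<bar> < \<bar>f z\<bar>}"
    define S where "S = {span {E, z} | z. z \<notin> span {E} \<and> \<bar>f z\<bar> < \<bar>g z\<bar>}"
    have W: "open W" unfolding W_def using cont by (intro open_Collect_less continuous_intros)
    have S_iff: "span {E, z} \<in> S \<longleftrightarrow> \<bar>f z\<bar> < \<bar>g z\<bar>" if "z \<notin> span {E}" for z
    proof
      assume "span {E, z} \<in> S"
      then obtain z' where z': "z' \<notin> span {E}" "\<bar>f z'\<bar> < \<bar>g z'\<bar>" "span {E, z} = span {E, z'}"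
        unfolding S_def by blast
      then show "\<bar>f z\<bar> < \<bar>g z\<bar>"
        using functionals_on_plane[OF fg(1-4) that, of z'] by simp
    next
      assume "\<bar>f z\<bar> < \<bar>g z\<bar>"
      then show "span {E, z} \<in> S" unfolding S_def using that by blast
    qed
    have "{z. z \<notin> span {E} \<and> span {E, z} \<in> S} = {z. z \<notin> span {E}} \<inter> {z. \<bar>f z\<bar> < \<bar>g z\<bar>}"
      using S_iff by blast
    moreover have "open {z. \<bar>f z\<bar> < \<bar>g z\<bar>}"
      using cont by (intro open_Collect_less continuous_intros)
    ultimately have S: "openin (planes_topology E) S"
      unfolding openin_planes_topology using open_off_ray[of E] by (auto simp: S_def intro: open_Int)
    have LS: "L E \<in> S" using S_iff[OF y(1)] fg y(2) by simp
    define N where "N = (cone_boundary A \<inter> W) \<times>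
        {l \<in> topspace (product_topology planes_topology P). l E \<in> S}"
    have N1: "openin (top_of_set (cone_boundary A)) (cone_boundary A \<inter> W)"
      using W by (rule openin_open_Int)
    have N2: "openin (product_topology planes_topology P)
        {l \<in> topspace (product_topology planes_topology P). l E \<in> S}"
      using continuous_map_product_projection[OF EP] S by (rule openin_continuous_map_preimage)
    have "openin ?T N" unfolding N_def using N1 N2 by (simp only: openin_prod_Times_iff) blast
    moreover have "(x, restrict L P) \<in> N"
      using top fg LS EP unfolding N_def W_def by (auto simp: mem_Times_iff)
    ultimately obtain w where w: "w \<in> ?G" "w \<in> N"
      using cl unfolding in_closure_of by blast
    then obtain z where z: "\<forall>E\<in>P. z \<notin> span {E}" "w = (z, \<lambda>E\<in>P. span {E, z})" by blast
    have "z \<in> W" "span {E, z} \<in> S" using w(2) EP unfolding z(2) N_def by auto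
    then show False using S_iff[of z] z(1) EP by (simp add: W_def)
  qed
  then have "L = (\<lambda>E\<in>parabolic A. span {E, x})"
    using ext by (intro extensionalityI[of _ "parabolic A"]) auto
  then show ?thesis by (simp add: irrational_lift_def x_def L_def prod_eq_iff)
qed

text \<open>The volume of a subset of the enlarged boundary therefore only depends on the lifts of
  irrational classes in it.\<close>

lemma irrational_part:
  "fst ` {a \<in> enlarged_boundary A Q \<omega>0. P a} \<inter> irrational_boundary A =
    {x \<in> irrational_boundary A. P (irrational_lift A x)}"
proof (intro subset_antisym subsetI)
  fix x assume "x \<in> fst ` {a \<in> enlarged_boundary A Q \<omega>0. P a} \<inter> irrational_boundary A"
  then obtain a where a: "a \<in> enlarged_boundary A Q \<omega>0" "P a" "x = fst a" "x \<in> irrational_boundary A"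
    by blast
  then have "a = irrational_lift A x" using enlarged_boundary_over_irrational by blast
  then show "x \<in> {x \<in> irrational_boundary A. P (irrational_lift A x)}" using a by simp
next
  fix x assume "x \<in> {x \<in> irrational_boundary A. P (irrational_lift A x)}"
  then have x: "x \<in> irrational_boundary A" "P (irrational_lift A x)" by simp_all
  have "irrational_lift A x \<in> enlarged_boundary A Q \<omega>0"
    using x(1) by (rule irrational_lift_in_enlarged_boundary)
  moreover have "x = fst (irrational_lift A x)" by (simp add: irrational_lift_def)
  ultimately show "x \<in> fst ` {a \<in> enlarged_boundary A Q \<omega>0. P a} \<inter> irrational_boundary A"
    using x by blast
qed

section \<open>Isometries preserving the lattice and the ample cone\<close>

locale lattice_isometry =
  fixes A :: "(real ^ 'r) set" and Q :: "real ^ 'r \<Rightarrow> real ^ 'r \<Rightarrow> real" and T :: "real ^ 'r \<Rightarrow> real ^ 'r"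
  assumes lin: "linear T" and isometry: "\<And>v w. Q (T v) (T w) = Q v w"
    and lattice: "T ` integral_vectors = integral_vectors" and cone: "T ` A = A"
begin

lemma surj: "surj T"
proof -
  have "Basis \<subseteq> (integral_vectors :: (real ^ 'r) set)"
    using axis_integral by (auto simp: Basis_vec_def)
  then have "span integral_vectors = (UNIV :: (real ^ 'r) set)"
    using span_mono span_Basis by blast
  then have "T ` UNIV = UNIV"
    using linear_span_image[OF lin, of integral_vectors] by (simp add: lattice)
  then show ?thesis by simp
qed

lemma inj: "inj T"
  by (rule linear_surjective_imp_injective[OF lin surj]) simp

lemma inv_apply: "the_inv T (T v) = v"
  using the_inv_f_f[OF inj] .

lemma apply_inv: "T (the_inv T v) = v"
  using surj inv_apply by (metis surjD)

lemma integral_iff: "T v \<in> integral_vectors \<longleftrightarrow> v \<in> integral_vectors"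
  using inj_image_mem_iff[OF inj, of v integral_vectors] by (simp add: lattice)

lemma cone_boundary_iff: "T v \<in> cone_boundary A \<longleftrightarrow> v \<in> cone_boundary A"
proof -
  have "T ` frontier A = T ` closure A - T ` interior A"
    using inj by (simp add: frontier_def image_set_diff)
  also have "\<dots> = frontier A"
    using closure_injective_linear_image[OF lin inj, of A] interior_injective_linear_image[OF lin inj, of A]
    by (simp add: frontier_def cone)
  finally have "T v \<in> frontier A \<longleftrightarrow> v \<in> frontier A" using inj_image_mem_iff[OF inj] by metis
  moreover have "T v = 0 \<longleftrightarrow> v = 0" using inj lin by (metis injD linear_0)
  ultimately show ?thesis by (simp add: cone_boundary_def)
qed

lemma irrational_boundary_iff: "T v \<in> irrational_boundary A \<longleftrightarrow> v \<in> irrational_boundary A"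
  unfolding irrational_boundary_integral
  by (simp add: cone_boundary_iff integral_iff flip: linear_scale[OF lin])

lemma parabolic_iff: "T E \<in> parabolic A \<longleftrightarrow> E \<in> parabolic A"
proof -
  have "(\<forall>w\<in>integral_vectors. \<forall>n::nat. T E = real n *\<^sub>R w \<longrightarrow> n = 1) \<longleftrightarrow>
      (\<forall>w\<in>T ` integral_vectors. \<forall>n::nat. T E = real n *\<^sub>R w \<longrightarrow> n = 1)"
    by (simp only: lattice)
  also have "\<dots> \<longleftrightarrow> (\<forall>w\<in>integral_vectors. \<forall>n::nat. E = real n *\<^sub>R w \<longrightarrow> n = 1)"
    by (simp add: inj_eq[OF inj] flip: linear_scale[OF lin])
  finally show ?thesis by (simp add: parabolic_def cone_boundary_iff integral_iff)
qed

text \<open>The isometry permutes the parabolic classes, so it maps the plane of \<open>x\<close> and a parabolic \<open>F\<close> to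
  that of \<open>T x\<close> and the parabolic class \<open>T F\<close>.\<close>

lemma boundary_map_irrational_lift: "boundary_map A T (irrational_lift A x) = irrational_lift A (T x)"
proof -
  have "T ` snd (irrational_lift A x) (the_inv T E) = span {E, T x}" if "E \<in> parabolic A" for E
  proof -
    obtain F where F: "E = T F" using surj by (metis surjD)
    then have "F \<in> parabolic A" using that parabolic_iff by simp
    then show ?thesis
      using linear_span_image[OF lin, of "{F, x}"]
      by (simp add: F inv_apply irrational_lift_def)
  qed
  then show ?thesis
    by (simp add: boundary_map_def irrational_lift_def cong: restrict_cong)
qed

lemma image_component:
  assumes "C \<in> components {v. Q v v > 0}"
  shows "T ` C \<in> components {v. Q v v > 0}"
proof -
  have C: "C \<noteq> {}" "C \<subseteq> {v. Q v v > 0}" "connected C"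
    "\<And>D. D \<noteq> {} \<Longrightarrow> C \<subseteq> D \<Longrightarrow> D \<subseteq> {v. Q v v > 0} \<Longrightarrow> connected D \<Longrightarrow> D = C"
    using assms unfolding in_components_maximal by auto
  obtain S where S: "linear S" "S \<circ> T = id" using linear_injective_left_inverse[OF lin inj] by blast
  have TS: "T (S v) = v" and ST: "S (T v) = v" for v
    using S(2) surj by (metis comp_apply id_apply surjD)+
  have cont: "continuous_on D T" "continuous_on D S" for D
    using lin S(1) by (simp_all add: linear_continuous_on linear_conv_bounded_linear)
  have "D = T ` C" if D: "D \<noteq> {}" "T ` C \<subseteq> D" "D \<subseteq> {v. Q v v > 0}" "connected D" for D
  proof -
    have "C \<subseteq> S ` D" using D(2) ST by (metis image_eqI image_subset_iff subsetI)
    moreover have "S ` D \<subseteq> {v. Q v v > 0}"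
    proof
      fix v assume "v \<in> S ` D"
      then obtain d where d: "d \<in> D" "v = S d" by blast
      then have "Q v v = Q d d" using isometry[of v v] by (simp add: TS)
      then show "v \<in> {v. Q v v > 0}" using d(1) D(3) by auto
    qed
    moreover have "connected (S ` D)" using cont(2) D(4) by (rule connected_continuous_image)
    moreover have "S ` D \<noteq> {}" using D(1) by simp
    ultimately have "S ` D = C" by (intro C(4))
    moreover have "T ` S ` D = D" by (simp add: image_image TS)
    ultimately show ?thesis by simp
  qed
  then show ?thesis
    unfolding in_components_maximal
    using C(1,2) connected_continuous_image[OF cont(1) C(3)] isometry by auto
qed

end

text \<open>The symmetry between \<open>T\<close> and its inverse turns inclusions into equalities, both for the
  components of the positive classes and for measurability of images.\<close>

lemma (in lattice_isometry) inverse_isometry: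
  "lattice_isometry A Q (the_inv T)"
proof (rule lattice_isometry.intro)
  show "linear (the_inv T)"
    by (rule linearI; rule injD[OF inj]) (simp_all add: linear_add[OF lin] linear_scale[OF lin] apply_inv)
  show "Q (the_inv T v) (the_inv T w) = Q v w" for v w using isometry apply_inv by metis
  have *: "the_inv T ` T ` S = S" for S by (simp add: image_image inv_apply)
  show "the_inv T ` integral_vectors = integral_vectors" using *[of integral_vectors] by (simp add: lattice)
  show "the_inv T ` A = A" using *[of A] by (simp add: cone)
qed

context lattice_isometry
begin

lemma positive_isometry: "T \<in> positive_isometries A Q"
proof -
  interpret inv: lattice_isometry A Q "the_inv T" by (rule inverse_isometry)
  have 1: "T ` C \<in> {C \<in> components {v. Q v v > 0}. A \<subseteq> C}"
    if "C \<in> {C \<in> components {v. Q v v > 0}. A \<subseteq> C}" for C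
    using that image_component[of C] cone image_mono[of A C T] by auto
  have 2: "C = T ` (the_inv T ` C)" for C by (simp add: image_image apply_inv)
  have 3: "the_inv T ` C \<in> {C \<in> components {v. Q v v > 0}. A \<subseteq> C}"
    if "C \<in> {C \<in> components {v. Q v v > 0}. A \<subseteq> C}" for C
    using that inv.image_component[of C] inv.cone image_mono[of A C "the_inv T"] by auto
  have "(`) T ` {C \<in> components {v. Q v v > 0}. A \<subseteq> C} = {C \<in> components {v. Q v v > 0}. A \<subseteq> C}"
    using 1 2 3 by blast
  then have "T ` positive_cone A Q = positive_cone A Q"
    unfolding positive_cone_def image_Union by simp
  then show ?thesis using lin isometry by (simp add: positive_isometries_def)
qed

lemma measurable_image:
  assumes "sets \<mu> = sets (restrict_space borel (cone_boundary A))" "B \<in> sets \<mu>"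
  shows "T ` B \<in> sets \<mu>"
proof -
  interpret inv: lattice_isometry A Q "the_inv T" by (rule inverse_isometry)
  obtain B' where B': "B' \<in> sets borel" "B = cone_boundary A \<inter> B'"
    using assms by (auto simp: sets_restrict_space)
  have "the_inv T \<in> borel_measurable borel"
    using inv.lin by (intro borel_measurable_continuous_onI linear_continuous_on)
      (simp add: linear_conv_bounded_linear)
  then have "the_inv T -` B' \<in> sets borel"
    using B'(1) by (rule measurable_sets_borel)
  moreover have "T ` B = cone_boundary A \<inter> the_inv T -` B'"
  proof (intro subset_antisym subsetI)
    fix y assume "y \<in> T ` B"
    then show "y \<in> cone_boundary A \<inter> the_inv T -` B'"
      by (auto simp: B'(2) cone_boundary_iff inv_apply)
  next
    fix y assume "y \<in> cone_boundary A \<inter> the_inv T -` B'"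
    then have "the_inv T y \<in> B" by (simp add: B'(2) inv.cone_boundary_iff)
    then have "T (the_inv T y) \<in> T ` B" by (rule imageI)
    then show "y \<in> T ` B" by (simp only: apply_inv)
  qed
  ultimately show ?thesis by (auto simp: assms(1) sets_restrict_space)
qed

text \<open>Invariance extends to sets that are not measurable: neither such a set nor its image has a
  measure, and both are assigned the value zero.\<close>

lemma natural_measure_image:
  assumes \<mu>: "natural_measure A Q \<mu>"
  shows "emeasure \<mu> (T ` B) = emeasure \<mu> B"
proof (cases "B \<in> sets \<mu>")
  case True
  then show ?thesis using \<mu> positive_isometry by (simp add: natural_measure_def)
next
  case False
  interpret inv: lattice_isometry A Q "the_inv T" by (rule inverse_isometry)
  have sets: "sets \<mu> = sets (restrict_space borel (cone_boundary A))"
    using \<mu> by (simp add: natural_measure_def)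
  have "the_inv T ` (T ` B) = B" by (simp add: image_image inv_apply)
  then have "T ` B \<notin> sets \<mu>" using inv.measurable_image[OF sets, of "T ` B"] False by auto
  then show ?thesis using False by (simp add: emeasure_notin_sets)
qed

lemma natural_volume_transfer:
  fixes h h' :: "'r boundary_point \<Rightarrow> real"
  assumes \<mu>: "natural_measure A Q \<mu>"
    and h: "\<And>a. a \<in> enlarged_boundary A Q \<omega>0 \<Longrightarrow> h' a = h (boundary_map A T a)"
  shows "natural_volume A \<mu> {a \<in> enlarged_boundary A Q \<omega>0. h' a \<le> 1} =
    natural_volume A \<mu> {a \<in> enlarged_boundary A Q \<omega>0. h a \<le> 1}"
proof -
  let ?S' = "{x \<in> irrational_boundary A. h' (irrational_lift A x) \<le> 1}"
  let ?S = "{x \<in> irrational_boundary A. h (irrational_lift A x) \<le> 1}"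
  have h': "h' (irrational_lift A x) = h (irrational_lift A (T x))" if "x \<in> irrational_boundary A" for x
    using h[OF irrational_lift_in_enlarged_boundary[OF that]] by (simp add: boundary_map_irrational_lift)
  have "T ` ?S' = ?S"
  proof (intro subset_antisym subsetI)
    fix y assume "y \<in> T ` ?S'"
    then show "y \<in> ?S" using h' irrational_boundary_iff by auto
  next
    fix y assume y: "y \<in> ?S"
    have "T (the_inv T y) = y" by (rule apply_inv)
    then have "the_inv T y \<in> ?S'"
      using y h'[of "the_inv T y"] irrational_boundary_iff[of "the_inv T y"] by simp
    then have "T (the_inv T y) \<in> T ` ?S'" by (rule imageI)
    then show "y \<in> T ` ?S'" by (simp only: apply_inv)
  qed
  then show ?thesis
    using natural_measure_image[OF \<mu>, of ?S'] by (simp add: natural_volume_def irrational_part)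
qed

end

section \<open>Invariance of the natural volume\<close>

text \<open>Automorphisms are only constrained on \<open>\<V>\<close>. Extending them by the identity makes precomposition
  a bijection on functions of all points, which exact transport requires.\<close>

lemma automorphism_extension:
  assumes "\<gamma> \<in> automorphisms \<V>"
  shows "automorphism \<V> (\<lambda>x. if x \<in> \<V> then \<gamma> x else x)" (is "automorphism \<V> ?\<sigma>")
proof
  have iso: "variety_iso \<V> \<V> \<gamma>" using assms by (simp add: automorphisms_def)
  then have "bij_betw \<gamma> \<V> \<V>" by (simp add: variety_iso_def)
  then have on: "bij_betw ?\<sigma> \<V> \<V>"
    by (subst bij_betw_cong[where g = \<gamma>]) simp_all
  have off: "bij_betw ?\<sigma> (- \<V>) (- \<V>)"
    by (subst bij_betw_cong[where g = id]) simp_all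
  show "bij ?\<sigma>"
    using bij_betw_combine[OF on off] by simp
  have vimage: "\<V> \<inter> ?\<sigma> -` W = \<V> \<inter> \<gamma> -` W" for W by auto
  have regular: "regular_on \<V> (\<V> \<inter> \<gamma> -` W) (f \<circ> ?\<sigma>) \<longleftrightarrow> regular_on \<V> (\<V> \<inter> \<gamma> -` W) (f \<circ> \<gamma>)" for W f
    by (rule regular_on_cong) simp
  show "variety_iso \<V> \<V> ?\<sigma>"
    using iso on unfolding variety_iso_def vimage regular by blast
qed

theorem theoremH:
  fixes \<V> :: "'k::field_char_0 alg_closure point set"
    and cls :: "'k alg_closure divisor \<Rightarrow> real ^ 'r"
    and Q :: "real ^ 'r \<Rightarrow> real ^ 'r \<Rightarrow> real"
    and \<omega>0 :: "real ^ 'r"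
    and \<mu> :: "(real ^ 'r) measure"
    and h :: "'r boundary_point \<Rightarrow> 'k alg_closure point \<Rightarrow> real"
  assumes "number_field TYPE('k)"
    and "projective_set (range to_ac) N \<V>"
    and "K3_surface \<V>"
    and "NS_marking \<V> cls"
    and "CARD('r) \<ge> 3"
    and "\<not> (\<exists>C. minus_two_curve \<V> C)"
    and "intersection_form \<V> cls Q"
    and "\<omega>0 \<in> ample_cone \<V> cls"
    and "natural_measure (ample_cone \<V> cls) Q \<mu>"
    and "canonical_height \<V> cls Q \<omega>0 h"
    and "p \<in> \<V>"
  shows "(\<lambda>q. natural_volume (ample_cone \<V> cls) \<mu>
            {a \<in> enlarged_boundary (ample_cone \<V> cls) Q \<omega>0. h a q \<le> 1})
         constant_on {\<gamma> p | \<gamma>. \<gamma> \<in> automorphisms \<V>}"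
proof -
  let ?A = "ample_cone \<V> cls"
  let ?vol = "\<lambda>q. natural_volume ?A \<mu> {a \<in> enlarged_boundary ?A Q \<omega>0. h a q \<le> 1}"
  have "?vol (\<gamma> p) = ?vol p" if \<gamma>: "\<gamma> \<in> automorphisms \<V>" for \<gamma>
  proof -
    define \<sigma> where "\<sigma> = (\<lambda>x. if x \<in> \<V> then \<gamma> x else x)"
    interpret automorphism \<V> \<sigma> unfolding \<sigma>_def using \<gamma> by (rule automorphism_extension)
    interpret marked_automorphism \<V> N \<sigma> cls
    proof
      show "\<V> \<subseteq> proj_space N" using assms(2) by (auto simp: projective_set_def)
      show "irreducible_closed \<V> \<V>" using assms(3) by (simp add: K3_surface_def)
      show "NS_marking \<V> cls" by (rule assms(4))
    qed
    let ?T = "NS_pullback \<V> cls \<gamma>"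
    have agree: "\<And>x. x \<in> \<V> \<Longrightarrow> \<gamma> x = \<sigma> x" by (simp add: \<sigma>_def)
    have lin: "linear ?T" by (rule NS_action(1)) (rule agree)
    have action: "?T (cls D) = cls (pull D)" if "cartier \<V> D" for D
      using agree that by (rule NS_action(2))
    interpret lattice_isometry ?A Q ?T
    proof (rule lattice_isometry.intro)
      show "linear ?T" by (rule lin)
      show "Q (?T v) (?T w) = Q v w" for v w
        by (intro NS_action_isometry[OF lin] action assms(7))
      show "?T ` integral_vectors = integral_vectors"
        by (intro NS_action_integral[OF lin] action)
      show "?T ` ?A = ?A"
        by (intro NS_action_ample_cone[OF lin] action)
    qed
    have "h a (\<gamma> p) = h (boundary_map ?A ?T a) p" if "a \<in> enlarged_boundary ?A Q \<omega>0" for a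
      using assms(10,11) \<gamma> that unfolding canonical_height_def Let_def by blast
    then show ?thesis by (rule natural_volume_transfer[OF assms(9)])
  qed
  then show ?thesis unfolding constant_on_def by blast
qed

end
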